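(* Let $\Gamma$ be a nontrivial additive subgroup of $\mathbb{C}$ and let $W$ be the complex Lie algebra with basis $\{L_{\alpha,i}\mid\alpha\in\Gamma,\ i\in\mathbb{Z}_+\}$ and bracket $[L_{\alpha,i},L_{\beta,j}]=(\beta-\alpha)L_{\alpha+\beta,i+j}+(j-i)L_{\alpha+\beta,i+j-1}$. Then there is a group isomorphism $$\mathrm{Aut}\,W\cong\chi(\Gamma)\rtimes\Gamma^{\mathbb{C}^*}.$$
   Context: $\mathbb{Z}_+$ denotes the nonnegative integers and $\mathbb{C}^*$ the nonzero complex numbers. In the bracket of $W$, terms with second index $-1$ have coefficient $0$ and are read as $0$. $\mathrm{Aut}\,W$ is the group of Lie algebra automorphisms of $W$. $\chi(\Gamma)$ is the group of characters of $\Gamma$, i.e. of group homomorphisms $\tau:\Gamma\to\mathbb{C}^*$, and $\Gamma^{\mathbb{C}^*}=\{c\in\mathbb{C}^*\mid c\Gamma=\Gamma\}$. The semidirect product $\chi(\Gamma)\rtimes\Gamma^{\mathbb{C}^*}$ is the set $\chi(\Gamma)\times\Gamma^{\mathbb{C}^*}$ with multiplication $(\tau_1,c_1)\cdot(\tau_2,c_2)=(\tau,c_1c_2)$, where $\tau(\alpha)=\tau_1(c_2\alpha)\tau_2(\alpha)$ for $\alpha\in\Gamma$. *)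

theory Defs
  imports
    Complex_Main
    "HOL-Algebra.Bij"
    "HOL-Library.Poly_Mapping"
    "HOL-Library.Product_Plus"
begin

definition complex_add_group :: "complex monoid" where
  "complex_add_group = \<lparr>carrier = UNIV, monoid.mult = (+), one = 0\<rparr>"

definition complex_units :: "complex monoid" where
  "complex_units = \<lparr>carrier = - {0}, monoid.mult = (*), one = 1\<rparr>"

text \<open>
  Finitely supported functions on \<open>\<Gamma> \<times> \<nat>\<close>; the basis vector \<open>L \<alpha> i\<close> is the
  indicator of \<open>(\<alpha>, i)\<close>.
\<close>

definition L :: "complex \<Rightarrow> nat \<Rightarrow> (complex \<times> nat \<Rightarrow>\<^sub>0 complex)" where
  "L \<alpha> i = Poly_Mapping.single (\<alpha>, i) 1"

definition W :: "complex set \<Rightarrow> (complex \<times> nat \<Rightarrow>\<^sub>0 complex) set" where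
  "W \<Gamma> = {x. Poly_Mapping.keys x \<subseteq> \<Gamma> \<times> UNIV}"

definition scale :: "complex \<Rightarrow> ('k \<Rightarrow>\<^sub>0 complex) \<Rightarrow> ('k \<Rightarrow>\<^sub>0 complex)" where
  "scale c x = Poly_Mapping.map ((*) c) x"

text \<open>
  The truncated subtraction in \<open>i + j - 1\<close> is only relevant for \<open>i = j = 0\<close>, where the
  coefficient \<open>j - i\<close> of that term vanishes.
\<close>

definition L_bracket :: "complex \<Rightarrow> nat \<Rightarrow> complex \<Rightarrow> nat \<Rightarrow> (complex \<times> nat \<Rightarrow>\<^sub>0 complex)" where
  "L_bracket \<alpha> i \<beta> j =
     scale (\<beta> - \<alpha>) (L (\<alpha> + \<beta>) (i + j)) +
     scale (of_nat j - of_nat i) (L (\<alpha> + \<beta>) (i + j - 1))"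

definition bracket ::
  "(complex \<times> nat \<Rightarrow>\<^sub>0 complex) \<Rightarrow> (complex \<times> nat \<Rightarrow>\<^sub>0 complex) \<Rightarrow> (complex \<times> nat \<Rightarrow>\<^sub>0 complex)" where
  "bracket x y =
     (\<Sum>(\<alpha>, i)\<in>Poly_Mapping.keys x. \<Sum>(\<beta>, j)\<in>Poly_Mapping.keys y.
        scale (Poly_Mapping.lookup x (\<alpha>, i) * Poly_Mapping.lookup y (\<beta>, j)) (L_bracket \<alpha> i \<beta> j))"

definition lie_auto :: "complex set \<Rightarrow>
    ((complex \<times> nat \<Rightarrow>\<^sub>0 complex) \<Rightarrow> (complex \<times> nat \<Rightarrow>\<^sub>0 complex)) set" where
  "lie_auto \<Gamma> = {\<phi> \<in> Bij (W \<Gamma>).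
     (\<forall>x\<in>W \<Gamma>. \<forall>y\<in>W \<Gamma>. \<phi> (x + y) = \<phi> x + \<phi> y) \<and>
     (\<forall>c. \<forall>x\<in>W \<Gamma>. \<phi> (scale c x) = scale c (\<phi> x)) \<and>
     (\<forall>x\<in>W \<Gamma>. \<forall>y\<in>W \<Gamma>. \<phi> (bracket x y) = bracket (\<phi> x) (\<phi> y))}"

definition Aut_W :: "complex set \<Rightarrow>
    ((complex \<times> nat \<Rightarrow>\<^sub>0 complex) \<Rightarrow> (complex \<times> nat \<Rightarrow>\<^sub>0 complex)) monoid" where
  "Aut_W \<Gamma> = BijGroup (W \<Gamma>) \<lparr>carrier := lie_auto \<Gamma>\<rparr>"

definition characters :: "complex set \<Rightarrow> (complex \<Rightarrow> complex) set" where
  "characters \<Gamma> = hom (complex_add_group\<lparr>carrier := \<Gamma>\<rparr>) complex_units \<inter> extensional \<Gamma>"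

definition scale_stabilizer :: "complex set \<Rightarrow> complex set" where
  "scale_stabilizer \<Gamma> = {c. c \<noteq> 0 \<and> (\<lambda>\<alpha>. c * \<alpha>) ` \<Gamma> = \<Gamma>}"

definition char_semidirect :: "complex set \<Rightarrow> ((complex \<Rightarrow> complex) \<times> complex) monoid" where
  "char_semidirect \<Gamma> = \<lparr>
     carrier = characters \<Gamma> \<times> scale_stabilizer \<Gamma>,
     monoid.mult = (\<lambda>(\<tau>\<^sub>1, c\<^sub>1) (\<tau>\<^sub>2, c\<^sub>2). (\<lambda>\<alpha>\<in>\<Gamma>. \<tau>\<^sub>1 (c\<^sub>2 * \<alpha>) * \<tau>\<^sub>2 \<alpha>, c\<^sub>1 * c\<^sub>2)),
     one = (\<lambda>\<alpha>\<in>\<Gamma>. 1, 1)\<rparr>"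

lemma group_complex_add_group: "group complex_add_group"
  unfolding complex_add_group_def
  by (rule groupI) (auto simp: add.assoc add_eq_0_iff2)

lemma inv_complex_add_group: "inv\<^bsub>complex_add_group\<^esub> a = - a"
  by (rule group.inv_equality[OF group_complex_add_group]) (simp_all add: complex_add_group_def)

lemma subgroup_complex_add_group_iff:
  "subgroup \<Gamma> complex_add_group \<longleftrightarrow> 0 \<in> \<Gamma> \<and> (\<forall>a\<in>\<Gamma>. \<forall>b\<in>\<Gamma>. a + b \<in> \<Gamma>) \<and> (\<forall>a\<in>\<Gamma>. - a \<in> \<Gamma>)"
  unfolding subgroup_def inv_complex_add_group by (auto simp: complex_add_group_def)

lemma group_complex_units: "group complex_units"
  unfolding complex_units_def
proof (rule groupI, goal_cases)
  case (5 x)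
  then show ?case by (intro bexI[of _ "inverse x"]) auto
qed auto

lemma characters_iff:
  "\<tau> \<in> characters \<Gamma> \<longleftrightarrow> \<tau> \<in> extensional \<Gamma> \<and> (\<forall>\<alpha>\<in>\<Gamma>. \<tau> \<alpha> \<noteq> 0) \<and>
     (\<forall>\<alpha>\<in>\<Gamma>. \<forall>\<beta>\<in>\<Gamma>. \<tau> (\<alpha> + \<beta>) = \<tau> \<alpha> * \<tau> \<beta>)"
  by (auto simp: characters_def hom_def complex_add_group_def complex_units_def)

lemma scale_stabilizer_mem:
  assumes "c \<in> scale_stabilizer \<Gamma>" "\<alpha> \<in> \<Gamma>"
  shows "c * \<alpha> \<in> \<Gamma>" "inverse c * \<alpha> \<in> \<Gamma>"
proof -
  have c: "c \<noteq> 0" "(\<lambda>\<alpha>. c * \<alpha>) ` \<Gamma> = \<Gamma>" using assms(1) by (auto simp: scale_stabilizer_def)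
  show "c * \<alpha> \<in> \<Gamma>" using c assms(2) by blast
  obtain \<beta> where "\<beta> \<in> \<Gamma>" "\<alpha> = c * \<beta>" using c assms(2) by blast
  then show "inverse c * \<alpha> \<in> \<Gamma>" using c(1) by (simp add: mult.assoc[symmetric])
qed

lemma scale_stabilizerI:
  assumes "c \<noteq> 0" "\<And>\<alpha>. \<alpha> \<in> \<Gamma> \<Longrightarrow> c * \<alpha> \<in> \<Gamma>" "\<And>\<alpha>. \<alpha> \<in> \<Gamma> \<Longrightarrow> inverse c * \<alpha> \<in> \<Gamma>"
  shows "c \<in> scale_stabilizer \<Gamma>"
proof -
  have "\<alpha> \<in> (\<lambda>\<alpha>. c * \<alpha>) ` \<Gamma>" if "\<alpha> \<in> \<Gamma>" for \<alpha>
    using assms(1) assms(3)[OF that] by (intro image_eqI[of _ _ "inverse c * \<alpha>"]) auto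
  then show ?thesis using assms by (auto simp: scale_stabilizer_def)
qed

lemma scale_stabilizer_inverse:
  "c \<in> scale_stabilizer \<Gamma> \<Longrightarrow> inverse c \<in> scale_stabilizer \<Gamma>"
  by (rule scale_stabilizerI) (simp_all add: scale_stabilizer_mem, simp add: scale_stabilizer_def)

lemma scale_stabilizer_mult:
  assumes "c \<in> scale_stabilizer \<Gamma>" "d \<in> scale_stabilizer \<Gamma>"
  shows "c * d \<in> scale_stabilizer \<Gamma>"
proof (rule scale_stabilizerI)
  show "c * d \<noteq> 0" using assms by (auto simp: scale_stabilizer_def)
  show "c * d * \<alpha> \<in> \<Gamma>" if "\<alpha> \<in> \<Gamma>" for \<alpha>
    unfolding mult.assoc using assms that by (intro scale_stabilizer_mem)
  show "inverse (c * d) * \<alpha> \<in> \<Gamma>" if "\<alpha> \<in> \<Gamma>" for \<alpha>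
    unfolding inverse_mult_distrib mult.assoc using assms that by (intro scale_stabilizer_mem)
qed

lemma group_char_semidirect:
  assumes "subgroup \<Gamma> complex_add_group"
  shows "group (char_semidirect \<Gamma>)"
proof (rule groupI)
  have G: "0 \<in> \<Gamma>" "\<And>a b. a \<in> \<Gamma> \<Longrightarrow> b \<in> \<Gamma> \<Longrightarrow> a + b \<in> \<Gamma>"
    using assms by (auto simp: subgroup_complex_add_group_iff)
  show "x \<otimes>\<^bsub>char_semidirect \<Gamma>\<^esub> y \<in> carrier (char_semidirect \<Gamma>)"
    if "x \<in> carrier (char_semidirect \<Gamma>)" "y \<in> carrier (char_semidirect \<Gamma>)" for x y
    using that G by (auto simp: char_semidirect_def characters_iff scale_stabilizer_mem
        scale_stabilizer_mult distrib_left)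
  show "\<one>\<^bsub>char_semidirect \<Gamma>\<^esub> \<in> carrier (char_semidirect \<Gamma>)"
    using G by (auto simp: char_semidirect_def characters_iff scale_stabilizer_def)
  show "x \<otimes>\<^bsub>char_semidirect \<Gamma>\<^esub> y \<otimes>\<^bsub>char_semidirect \<Gamma>\<^esub> z
      = x \<otimes>\<^bsub>char_semidirect \<Gamma>\<^esub> (y \<otimes>\<^bsub>char_semidirect \<Gamma>\<^esub> z)"
    if "x \<in> carrier (char_semidirect \<Gamma>)" "y \<in> carrier (char_semidirect \<Gamma>)"
      "z \<in> carrier (char_semidirect \<Gamma>)" for x y z
    using that
    by (auto simp: char_semidirect_def scale_stabilizer_mem mult.assoc intro!: restrict_ext)
  show "\<one>\<^bsub>char_semidirect \<Gamma>\<^esub> \<otimes>\<^bsub>char_semidirect \<Gamma>\<^esub> x = x"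
    if "x \<in> carrier (char_semidirect \<Gamma>)" for x
    using that by (auto simp: char_semidirect_def scale_stabilizer_mem characters_iff
        fun_eq_iff extensional_def restrict_def)
  show "\<exists>y\<in>carrier (char_semidirect \<Gamma>). y \<otimes>\<^bsub>char_semidirect \<Gamma>\<^esub> x = \<one>\<^bsub>char_semidirect \<Gamma>\<^esub>"
    if x: "x \<in> carrier (char_semidirect \<Gamma>)" for x
  proof -
    obtain \<tau> c where x_eq: "x = (\<tau>, c)" by (cases x)
    have \<tau>: "\<tau> \<in> characters \<Gamma>" and c: "c \<in> scale_stabilizer \<Gamma>"
      using x by (auto simp: x_eq char_semidirect_def)
    have c0: "c \<noteq> 0" using c by (simp add: scale_stabilizer_def)
    let ?y = "(\<lambda>\<alpha>\<in>\<Gamma>. inverse (\<tau> (inverse c * \<alpha>)), inverse c)"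
    have "?y \<in> carrier (char_semidirect \<Gamma>)"
      using \<tau> c G by (auto simp: char_semidirect_def characters_iff scale_stabilizer_inverse
          scale_stabilizer_mem distrib_left)
    moreover have "?y \<otimes>\<^bsub>char_semidirect \<Gamma>\<^esub> x = \<one>\<^bsub>char_semidirect \<Gamma>\<^esub>"
      using \<tau> c c0 by (auto simp: x_eq char_semidirect_def scale_stabilizer_mem characters_iff
          mult.assoc[symmetric] intro!: restrict_ext)
    ultimately show ?thesis by blast
  qed
qed

lemma lookup_scale [simp]: "Poly_Mapping.lookup (scale c x) k = c * Poly_Mapping.lookup x k"
  by (simp add: scale_def Poly_Mapping.map.rep_eq when_def)

lemma bracket_single:
  "bracket (Poly_Mapping.single (\<alpha>, i) a) (Poly_Mapping.single (\<beta>, j) b)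
     = scale (a * b) (L_bracket \<alpha> i \<beta> j)"
proof -
  have "scale 0 x = 0" for x :: "complex \<times> nat \<Rightarrow>\<^sub>0 complex"
    by (rule poly_mapping_eqI) simp
  then show ?thesis
    by (cases "a = 0"; cases "b = 0") (simp_all add: bracket_def)
qed

lemma bracket_L: "bracket (L \<alpha> i) (L \<beta> j) = L_bracket \<alpha> i \<beta> j"
proof -
  have "scale 1 x = x" for x :: "complex \<times> nat \<Rightarrow>\<^sub>0 complex"
    by (rule poly_mapping_eqI) simp
  then show ?thesis unfolding L_def bracket_single by simp
qed

lemma W_add: "x \<in> W \<Gamma> \<Longrightarrow> y \<in> W \<Gamma> \<Longrightarrow> x + y \<in> W \<Gamma>"
  using Poly_Mapping.keys_add[of x y] by (auto simp: W_def)

lemma W_scale: "x \<in> W \<Gamma> \<Longrightarrow> scale c x \<in> W \<Gamma>"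
  by (auto simp: W_def in_keys_iff)

lemma W_sum: "(\<And>k. k \<in> A \<Longrightarrow> f k \<in> W \<Gamma>) \<Longrightarrow> sum f A \<in> W \<Gamma>"
  by (induction A rule: infinite_finite_induct) (auto simp: W_add, auto simp: W_def)

lemma W_bracket:
  assumes "subgroup \<Gamma> complex_add_group" "x \<in> W \<Gamma>" "y \<in> W \<Gamma>"
  shows "bracket x y \<in> W \<Gamma>"
proof -
  have L: "L_bracket \<alpha> i \<beta> j \<in> W \<Gamma>" if "\<alpha> \<in> \<Gamma>" "\<beta> \<in> \<Gamma>" for \<alpha> i \<beta> j
  proof -
    have "L (\<alpha> + \<beta>) k \<in> W \<Gamma>" for k
      using that assms(1) by (simp add: subgroup_complex_add_group_iff L_def W_def)
    then show ?thesis unfolding L_bracket_def by (intro W_add W_scale)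
  qed
  have "fst k \<in> \<Gamma>" if "k \<in> Poly_Mapping.keys x \<or> k \<in> Poly_Mapping.keys y" for k
    using that assms(2,3) by (auto simp: W_def)
  then show ?thesis
    unfolding bracket_def case_prod_beta by (intro W_sum W_scale L) blast+
qed

text \<open>
  With \<open>L \<alpha> i\<close> read as \<open>t\<^sup>i e\<^sup>\<alpha>\<^sup>t\<close> in the commutative convolution algebra, \<open>der\<close> is
  differentiation in \<open>t\<close> and the bracket is a Wronskian; the Lie algebra axioms follow.
\<close>

definition der :: "(complex \<times> nat \<Rightarrow>\<^sub>0 complex) \<Rightarrow> (complex \<times> nat \<Rightarrow>\<^sub>0 complex)" where
  "der x = (\<Sum>(\<alpha>, i)\<in>Poly_Mapping.keys x.
      Poly_Mapping.single (\<alpha>, i) (Poly_Mapping.lookup x (\<alpha>, i) * \<alpha>) +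
      Poly_Mapping.single (\<alpha>, i - 1) (Poly_Mapping.lookup x (\<alpha>, i) * of_nat i))"

lemma sum_keys_superset:
  assumes "finite A" "Poly_Mapping.keys x \<subseteq> A" "\<And>k. f k 0 = 0"
  shows "(\<Sum>k\<in>Poly_Mapping.keys x. f k (Poly_Mapping.lookup x k)) =
    (\<Sum>k\<in>A. f k (Poly_Mapping.lookup x k))"
  using assms by (intro sum.mono_neutral_left) (auto simp: in_keys_iff)

lemma der_add: "der (x + y) = der x + der y"
proof -
  let ?A = "Poly_Mapping.keys x \<union> Poly_Mapping.keys y"
  define f where "f = (\<lambda>(\<alpha>, i) a. Poly_Mapping.single (\<alpha>, i) (a * \<alpha>) +
      Poly_Mapping.single (\<alpha>, i - 1) (a * of_nat i) :: complex \<times> nat \<Rightarrow>\<^sub>0 complex)"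
  have d: "der z = (\<Sum>k\<in>?A. f k (Poly_Mapping.lookup z k))" if "Poly_Mapping.keys z \<subseteq> ?A" for z
  proof -
    have "der z = (\<Sum>k\<in>Poly_Mapping.keys z. f k (Poly_Mapping.lookup z k))"
      unfolding der_def f_def by (intro sum.cong) auto
    also have "\<dots> = (\<Sum>k\<in>?A. f k (Poly_Mapping.lookup z k))"
      using that by (intro sum_keys_superset) (auto simp: f_def)
    finally show ?thesis .
  qed
  have f: "f k (a + b) = f k a + f k b" for k a b
    by (cases k) (simp add: f_def single_add algebra_simps)
  show ?thesis
    using d[of x] d[of y] d[OF Poly_Mapping.keys_add[of x y]]
    by (simp add: lookup_add f sum.distrib)
qed

lemma der_single: "der (Poly_Mapping.single (\<alpha>, i) a) =
  Poly_Mapping.single (\<alpha>, i) (a * \<alpha>) + Poly_Mapping.single (\<alpha>, i - 1) (a * of_nat i)"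
  by (cases "a = 0") (simp_all add: der_def)

lemma sum_single_lookup:
  "(\<Sum>k\<in>Poly_Mapping.keys x. Poly_Mapping.single k (Poly_Mapping.lookup x k)) = x"
proof (rule poly_mapping_eqI)
  fix k
  show "Poly_Mapping.lookup (\<Sum>k\<in>Poly_Mapping.keys x.
      Poly_Mapping.single k (Poly_Mapping.lookup x k)) k = Poly_Mapping.lookup x k"
    by (cases "k \<in> Poly_Mapping.keys x")
      (simp_all add: lookup_sum lookup_single when_def in_keys_iff sum.delta)
qed

lemma pm_add_induct [case_names zero add]:
  assumes "P 0" "\<And>k a x. P x \<Longrightarrow> P (Poly_Mapping.single k a + x)"
  shows "P (x :: 'k \<Rightarrow>\<^sub>0 'v::comm_monoid_add)"
proof -
  have "P (\<Sum>k\<in>A. Poly_Mapping.single k (Poly_Mapping.lookup x k))" for A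
    by (induction A rule: infinite_finite_induct) (simp_all add: assms)
  then show ?thesis by (metis sum_single_lookup)
qed

lemma der_0 [simp]: "der 0 = 0" by (simp add: der_def)

lemma der_mult_single:
  "der (Poly_Mapping.single (\<alpha>, i) a * Poly_Mapping.single (\<beta>, j) b) =
   der (Poly_Mapping.single (\<alpha>, i) a) * Poly_Mapping.single (\<beta>, j) b +
   Poly_Mapping.single (\<alpha>, i) a * der (Poly_Mapping.single (\<beta>, j) b)"
proof -
  have 1: "Poly_Mapping.single (\<alpha> + \<beta>, i - 1 + j) (a * of_nat i * b)
      = Poly_Mapping.single (\<alpha> + \<beta>, i + j - 1) (a * of_nat i * b)"
    by (cases i) simp_all
  have 2: "Poly_Mapping.single (\<alpha> + \<beta>, i + (j - 1)) (a * (b * of_nat j))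
      = Poly_Mapping.single (\<alpha> + \<beta>, i + j - 1) (a * (b * of_nat j))"
    by (cases j) simp_all
  show ?thesis
    unfolding mult_single plus_prod_def fst_conv snd_conv der_single distrib_left distrib_right 1 2
    by (simp add: algebra_simps flip: single_add)
qed

lemma der_mult: "der (x * y) = der x * y + x * der y"
proof (induction x rule: pm_add_induct)
  case (add k a x)
  have "der (Poly_Mapping.single k a * y) =
      der (Poly_Mapping.single k a) * y + Poly_Mapping.single k a * der y"
  proof (induction y rule: pm_add_induct)
    case (add l b y)
    show ?case
      using add der_mult_single[of "fst k" "snd k" a "fst l" "snd l" b]
      by (simp add: der_add distrib_left add_ac)
  qed simp
  then show ?case
    using add by (simp add: der_add distrib_right add_ac)
qed simp

lemma L_bracket_eq: "L_bracket \<alpha> i \<beta> j = L \<alpha> i * der (L \<beta> j) - der (L \<alpha> i) * L \<beta> j"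
proof -
  have s: "scale c (Poly_Mapping.single k a) = Poly_Mapping.single k (c * a)"
    for c a and k :: "complex \<times> nat"
    by (rule poly_mapping_eqI) (simp add: lookup_single when_def)
  have 1: "Poly_Mapping.single (\<alpha> + \<beta>, i - 1 + j) (of_nat i :: complex)
      = Poly_Mapping.single (\<alpha> + \<beta>, i + j - 1) (of_nat i)"
    by (cases i) simp_all
  have 2: "Poly_Mapping.single (\<alpha> + \<beta>, i + (j - 1)) (of_nat j :: complex)
      = Poly_Mapping.single (\<alpha> + \<beta>, i + j - 1) (of_nat j)"
    by (cases j) simp_all
  show ?thesis
    unfolding L_bracket_def L_def s der_single distrib_left distrib_right mult_single
      plus_prod_def fst_conv snd_conv mult_1_left mult_1_right 1 2
    by (simp add: single_diff)
qed

lemma scale_eq_mult: "scale c x = Poly_Mapping.single 0 c * (x :: complex \<times> nat \<Rightarrow>\<^sub>0 complex)"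
  by (simp add: scale_def mult_map_scale_conv_mult)

lemma der_scale: "der (scale c x) = scale c (der x)"
  using der_single[of 0 0 c] by (simp add: scale_eq_mult der_mult zero_prod_def)

lemma bracket_eq: "bracket x y = x * der y - der x * y"
proof -
  have L: "scale (a * b) (L_bracket \<alpha> i \<beta> j) =
      Poly_Mapping.single (\<alpha>, i) a * der (Poly_Mapping.single (\<beta>, j) b)
      - der (Poly_Mapping.single (\<alpha>, i) a) * Poly_Mapping.single (\<beta>, j) b" for \<alpha> i \<beta> j a b
  proof -
    have s: "Poly_Mapping.single (\<gamma>, k) c = scale c (L \<gamma> k)" for \<gamma> k c
      by (rule poly_mapping_eqI) (simp add: L_def lookup_single when_def)
    have m: "Poly_Mapping.single (0 :: complex \<times> nat) (a * b) =
        Poly_Mapping.single 0 a * Poly_Mapping.single 0 b"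
      by (simp add: mult_single)
    show ?thesis
      unfolding s der_scale L_bracket_eq unfolding scale_eq_mult m by (simp add: algebra_simps)
  qed
  define p where "p = (\<lambda>(z :: complex \<times> nat \<Rightarrow>\<^sub>0 complex) k.
    Poly_Mapping.single k (Poly_Mapping.lookup z k))"
  have d: "der (sum f A) = (\<Sum>k\<in>A. der (f k))"
    for f and A :: "(complex \<times> nat) set"
    by (induction A rule: infinite_finite_induct) (simp_all add: der_add)
  have "bracket x y = (\<Sum>k\<in>Poly_Mapping.keys x. \<Sum>l\<in>Poly_Mapping.keys y.
      p x k * der (p y l) - der (p x k) * p y l)"
    unfolding bracket_def p_def by (intro sum.cong refl) (auto simp: L intro!: sum.cong)
  also have "\<dots> = sum (p x) (Poly_Mapping.keys x) * der (sum (p y) (Poly_Mapping.keys y))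
      - der (sum (p x) (Poly_Mapping.keys x)) * sum (p y) (Poly_Mapping.keys y)"
    by (simp add: d sum_subtractf sum_product)
  also have "\<dots> = x * der y - der x * y"
    unfolding p_def sum_single_lookup ..
  finally show ?thesis .
qed

lemma bracket_add_left: "bracket (x + y) z = bracket x z + bracket y z"
  and bracket_add_right: "bracket x (y + z) = bracket x y + bracket x z"
  and bracket_scale_left: "bracket (scale c x) y = scale c (bracket x y)"
  and bracket_scale_right: "bracket x (scale c y) = scale c (bracket x y)"
  and bracket_self: "bracket x x = 0"
  and bracket_jacobi:
    "bracket x (bracket y z) + bracket y (bracket z x) + bracket z (bracket x y) = 0"
proof -
  have dd: "der (a - b) = der a - der b" for a b
    using der_add[of "a - b" b] by simp
  show "bracket (x + y) z = bracket x z + bracket y z"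
    "bracket x (y + z) = bracket x y + bracket x z" "bracket x x = 0"
    by (simp_all add: bracket_eq der_add algebra_simps)
  show "bracket (scale c x) y = scale c (bracket x y)"
    "bracket x (scale c y) = scale c (bracket x y)"
    unfolding bracket_eq der_scale unfolding scale_eq_mult by (simp_all add: algebra_simps)
  show "bracket x (bracket y z) + bracket y (bracket z x) + bracket z (bracket x y) = 0"
    by (simp add: bracket_eq dd der_add der_mult algebra_simps)
qed

lemma group_Aut_W:
  assumes "subgroup \<Gamma> complex_add_group"
  shows "group (Aut_W \<Gamma>)"
proof -
  note BG = group_BijGroup[of "W \<Gamma>"]
  have "subgroup (lie_auto \<Gamma>) (BijGroup (W \<Gamma>))"
  proof (rule group.subgroupI[OF BG])
    show "lie_auto \<Gamma> \<subseteq> carrier (BijGroup (W \<Gamma>))"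
      by (auto simp: lie_auto_def BijGroup_def)
    have "(\<lambda>x\<in>W \<Gamma>. x) \<in> lie_auto \<Gamma>"
      by (auto simp: lie_auto_def id_Bij W_add W_scale W_bracket[OF assms])
    then show "lie_auto \<Gamma> \<noteq> {}" by blast
  next
    fix \<phi> assume \<phi>: "\<phi> \<in> lie_auto \<Gamma>"
    then have B: "\<phi> \<in> Bij (W \<Gamma>)" by (simp add: lie_auto_def)
    define \<psi> where "\<psi> = (\<lambda>x\<in>W \<Gamma>. inv_into (W \<Gamma>) \<phi> x)"
    have inv: "inv\<^bsub>BijGroup (W \<Gamma>)\<^esub> \<phi> = \<psi>"
      unfolding \<psi>_def using B
      by (intro group.inv_equality[OF BG])
        (auto simp: BijGroup_def Bij_compose_restrict_eq restrict_inv_into_Bij)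
    have bij: "bij_betw \<phi> (W \<Gamma>) (W \<Gamma>)" using B by (simp add: Bij_def)
    have \<psi>1: "\<psi> y \<in> W \<Gamma>" "\<phi> (\<psi> y) = y" if "y \<in> W \<Gamma>" for y
      using bij that by (auto simp: \<psi>_def Bij_inv_into_mem[OF B] bij_betw_inv_into_right)
    have \<psi>2: "\<psi> (\<phi> x) = x" if "x \<in> W \<Gamma>" for x
      using bij that by (auto simp: \<psi>_def bij_betw_inv_into_left bij_betwE)
    have "\<psi> \<in> lie_auto \<Gamma>"
      unfolding lie_auto_def
    proof (intro CollectI conjI ballI allI)
      show "\<psi> \<in> Bij (W \<Gamma>)" unfolding \<psi>_def by (rule restrict_inv_into_Bij[OF B])
      fix x y c assume x: "x \<in> W \<Gamma>"
      have "\<psi> (scale c (\<phi> (\<psi> x))) = \<psi> (\<phi> (scale c (\<psi> x)))"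
        using \<phi> \<psi>1[OF x] by (simp add: lie_auto_def)
      then show "\<psi> (scale c x) = scale c (\<psi> x)"
        using \<psi>1[OF x] by (simp add: \<psi>2 W_scale)
      assume y: "y \<in> W \<Gamma>"
      have "\<psi> (\<phi> (\<psi> x) + \<phi> (\<psi> y)) = \<psi> (\<phi> (\<psi> x + \<psi> y))"
        using \<phi> \<psi>1[OF x] \<psi>1[OF y] by (simp add: lie_auto_def)
      then show "\<psi> (x + y) = \<psi> x + \<psi> y"
        using \<psi>1[OF x] \<psi>1[OF y] by (simp add: \<psi>2 W_add)
      have "\<psi> (bracket (\<phi> (\<psi> x)) (\<phi> (\<psi> y))) = \<psi> (\<phi> (bracket (\<psi> x) (\<psi> y)))"
        using \<phi> \<psi>1[OF x] \<psi>1[OF y] by (simp add: lie_auto_def)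
      then show "\<psi> (bracket x y) = bracket (\<psi> x) (\<psi> y)"
        using \<psi>1[OF x] \<psi>1[OF y] by (simp add: \<psi>2 W_bracket[OF assms])
    qed
    then show "inv\<^bsub>BijGroup (W \<Gamma>)\<^esub> \<phi> \<in> lie_auto \<Gamma>" by (simp add: inv)
  next
    fix \<phi> \<psi> assume *: "\<phi> \<in> lie_auto \<Gamma>" "\<psi> \<in> lie_auto \<Gamma>"
    then have B: "\<phi> \<in> Bij (W \<Gamma>)" "\<psi> \<in> Bij (W \<Gamma>)" by (simp_all add: lie_auto_def)
    have m: "\<psi> x \<in> W \<Gamma>" if "x \<in> W \<Gamma>" for x
      using Bij_imp_funcset[OF B(2)] that by blast
    have "compose (W \<Gamma>) \<phi> \<psi> \<in> lie_auto \<Gamma>"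
      using * by (simp add: lie_auto_def compose_Bij compose_eq W_add W_scale W_bracket[OF assms] m)
    then show "\<phi> \<otimes>\<^bsub>BijGroup (W \<Gamma>)\<^esub> \<psi> \<in> lie_auto \<Gamma>"
      using B by (simp add: BijGroup_def)
  qed
  then show ?thesis
    unfolding Aut_W_def by (rule group.subgroup_imp_group[OF BG])
qed

end

theory Submission
  imports
    Defs
    "HOL-Analysis.Continuum_Not_Denumerable"
    "HOL-Computational_Algebra.Polynomial"
    "HOL-Library.Product_Lexorder"
begin

text \<open>
  Read \<open>L \<alpha> i\<close> as \<open>t\<^sup>i e\<^sup>\<alpha>\<^sup>t\<close>. Besides the characters \<open>\<tau>\<close> and the dilations \<open>c\<close>, the shifts
  \<open>t \<mapsto> t + b\<close> also act by automorphisms: the automorphisms of \<open>W\<close> are exactly the maps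
  \<open>t\<^sup>i e\<^sup>\<alpha>\<^sup>t \<mapsto> c\<^sup>-\<^sup>1 \<tau>(\<alpha>) (c t + b)\<^sup>i e\<^sup>c\<^sup>\<alpha>\<^sup>t\<close>, so that \<open>Aut W\<close> is naturally the semidirect
  product of \<open>\<chi>(\<Gamma>) \<times> \<complex>\<close> with the stabilizer of \<open>\<Gamma>\<close>. There are no others, because the elements
  acting locally finitely in the adjoint representation are the constants.

  The additional factor \<open>\<complex>\<close> does not change the isomorphism type: a Hamel basis of \<open>\<complex>\<close> over the
  rationals embeds \<open>\<complex>[X]\<close> into \<open>\<chi>(\<Gamma>)\<close>, equivariantly under the ring of multipliers of \<open>\<Gamma>\<close>; since
  \<open>\<complex>[X]\<close> is an injective module over this ring, it splits off, and \<open>\<complex>[X] \<cong> \<complex>[X] \<times> \<complex>\<close> yields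
  \<open>\<chi>(\<Gamma>) \<cong> \<chi>(\<Gamma>) \<times> \<complex>\<close> equivariantly.
\<close>

section \<open>Characters absorb a complex factor\<close>

text \<open>The map is \<open>exp \<circ> \<Phi>\<close> for a rational-linear injection
  \<open>\<Phi>\<close> whose range meets the rational line through \<open>2 * pi * \<i>\<close>,
  hence the kernel of \<open>exp\<close>, only in 0.\<close>

lemma exists_poly_embedding:
  "\<exists>e :: complex poly \<Rightarrow> complex. (\<forall>p q. e (p + q) = e p * e q) \<and> (\<forall>p. e p = 1 \<longleftrightarrow> p = 0)"
proof -
  define s :: "rat \<Rightarrow> complex \<Rightarrow> complex" where "s = (\<lambda>q x. of_rat q * x)"
  interpret Q: vector_space s
    by unfold_locales (simp_all add: s_def of_rat_add of_rat_mult algebra_simps)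
  interpret QQ: vector_space_pair s s ..
  \<comment> \<open>\<open>w\<close> generates the kernel of \<open>exp\<close>; it is made a basis
    vector so that the range of \<open>\<Phi>\<close> can avoid it coordinatewise.\<close>
  define w where "w = 2 * of_real pi * \<i>"
  have w: "Q.independent {w}" by (simp add: Q.dependent_single w_def)
  define B where "B = Q.extend_basis {w}"
  have B: "Q.independent B" "Q.span B = UNIV" "w \<in> B"
    using Q.independent_extend_basis[OF w] Q.span_extend_basis[OF w] Q.extend_basis_superset[OF w]
    by (auto simp: B_def)
  \<comment> \<open>Finite rational dimension would make the complex numbers countable, so the Hamel
    basis is infinite.\<close>
  have countable_span: "countable (Q.span S)" if "finite S" for S
    using that
  proof induction
    case (insert a S)
    have "Q.span (insert a S) \<subseteq> (\<lambda>(k, y). s k a + y) ` (UNIV \<times> Q.span S)"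
    proof
      fix x assume "x \<in> Q.span (insert a S)"
      then obtain k where "x - s k a \<in> Q.span S" by (auto simp: Q.span_insert)
      then show "x \<in> (\<lambda>(k, y). s k a + y) ` (UNIV \<times> Q.span S)"
        by (intro image_eqI[of _ _ "(k, x - s k a)"]) auto
    qed
    moreover have "countable ((\<lambda>(k, y). s k a + y) ` (UNIV \<times> Q.span S))"
      using insert.IH by (intro countable_image countable_SIGMA) auto
    ultimately show ?case by (rule countable_subset)
  qed simp
  have inf: "infinite B"
    using countable_span[of B] B(2) uncountable_UNIV_complex by auto
  obtain h where h: "bij_betw h B (B - {w})" using infinite_imp_bij_betw[OF inf] by blast
  have "(card_of (B \<times> (UNIV :: nat set)), card_of B) \<in> ordIso"
    using inf by (intro card_of_Times_infinite[THEN conjunct1]) (auto simp: infinite_iff_card_of_nat)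
  then obtain f where f: "bij_betw f (B \<times> (UNIV :: nat set)) B"
    unfolding card_of_ordIso[symmetric] by blast
  \<comment> \<open>\<open>g\<close> injects \<open>B \<times> UNIV\<close> into
    \<open>B - {w}\<close>: \<open>g b n\<close> is a private copy of \<open>b\<close> for the
    \<open>n\<close>-th coefficient.\<close>
  define g where "g = (\<lambda>b n. h (f (b, n)))"
  have g: "g b n \<in> B - {w}" if "b \<in> B" for b n
    using that unfolding g_def by (intro bij_betwE[OF h, rule_format] bij_betwE[OF f, rule_format]) simp
  have g_inj: "g b n = g b' n' \<longleftrightarrow> b = b' \<and> n = n'" if "b \<in> B" "b' \<in> B" for b b' n n'
  proof
    assume "g b n = g b' n'"
    moreover have "f (b, n) \<in> B" "f (b', n') \<in> B" using f that by (auto simp: bij_betw_def)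
    ultimately have "f (b, n) = f (b', n')" using h by (auto simp: g_def bij_betw_def inj_on_def)
    then have "(b, n) = (b', n')" using f that unfolding bij_betw_def inj_on_def by blast
    then show "b = b' \<and> n = n'" by simp
  qed simp
  define \<Lambda> where "\<Lambda> = (\<lambda>n. QQ.construct B (\<lambda>b. g b n))"
  have \<Lambda>: "Vector_Spaces.linear s s (\<Lambda> n)" for n
    unfolding \<Lambda>_def by (rule QQ.linear_construct[OF B(1)])
  have \<Lambda>_add: "\<Lambda> n (x + y) = \<Lambda> n x + \<Lambda> n y" for n x y
    using \<Lambda>[of n] by (simp add: Vector_Spaces.linear_iff)
  have \<Lambda>_0: "\<Lambda> n 0 = 0" for n using \<Lambda>_add[of n 0 0] by simp
  interpret QR: vector_space_pair s "(*) :: rat \<Rightarrow> rat \<Rightarrow> rat"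
    by unfold_locales (simp_all add: algebra_simps)
  have coord: "Vector_Spaces.linear s (*) (\<lambda>x. Q.representation B x c)" for c
    by (rule Q.linear_representation[OF B(1,2)])
  \<comment> \<open>The coordinate at \<open>g b n\<close> sees only \<open>\<Lambda> n\<close>, so
    the sum \<open>\<Phi> p\<close> still determines every coefficient of \<open>p\<close>. By
    linearity the identity is checked on \<open>B\<close>.\<close>
  have rep_\<Lambda>: "Q.representation B (\<Lambda> m x) (g b n) = (if m = n then Q.representation B x b else 0)"
    if b: "b \<in> B" for m n b x
  proof -
    have 1: "Vector_Spaces.linear s (*) (\<lambda>x. Q.representation B (\<Lambda> m x) (g b n))"
      using Vector_Spaces.linear_compose[OF \<Lambda> coord] by (simp add: o_def)
    have 2: "Vector_Spaces.linear s (*) (\<lambda>x. if m = n then Q.representation B x b else 0)"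
    proof (cases "m = n")
      case True then show ?thesis using coord by simp
    next
      case False then show ?thesis using QR.linear_zero by simp
    qed
    show ?thesis
    proof (rule QR.linear_eq_on[OF 1 2])
      show "x \<in> Q.span B" using B by simp
      fix c assume c: "c \<in> B"
      have "\<Lambda> m c = g c m" unfolding \<Lambda>_def by (rule QQ.construct_basis[OF B(1) c])
      then show "Q.representation B (\<Lambda> m c) (g b n) = (if m = n then Q.representation B c b else 0)"
        using c b g[of c m] g_inj[OF b c] by (auto simp: Q.representation_basis[OF B(1)])
    qed
  qed
  define \<Phi> where "\<Phi> = (\<lambda>p. \<Sum>n\<le>degree p. \<Lambda> n (coeff p n))"
  have \<Phi>: "\<Phi> p = (\<Sum>n\<le>N. \<Lambda> n (coeff p n))" if "degree p \<le> N" for p N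
    unfolding \<Phi>_def using that
    by (intro sum.mono_neutral_left) (auto simp: coeff_eq_0 \<Lambda>_0)
  have \<Phi>_add: "\<Phi> (p + q) = \<Phi> p + \<Phi> q" for p q
    using degree_add_le_max[of p q]
    by (simp add: \<Phi>[of _ "max (degree p) (degree q)"] \<Lambda>_add sum.distrib)
  have rep_\<Phi>: "Q.representation B (\<Phi> p) (g b n) = Q.representation B (coeff p n) b"
    if "b \<in> B" for p b n
  proof -
    have "Q.representation B (\<Phi> p) (g b n)
        = (\<Sum>m\<le>max n (degree p). Q.representation B (\<Lambda> m (coeff p m)) (g b n))"
      by (simp add: \<Phi>[of p "max n (degree p)"] Q.representation_sum B)
    then show ?thesis using that by (simp add: rep_\<Lambda>)
  qed
  show ?thesis
  proof (intro exI[of _ "\<lambda>p. exp (\<Phi> p)"] conjI allI iffI)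
    show "exp (\<Phi> p) = 1" if "p = 0" for p using that by (simp add: \<Phi>_def \<Lambda>_0)
    show "exp (\<Phi> (p + q)) = exp (\<Phi> p) * exp (\<Phi> q)" for p q
      by (simp add: \<Phi>_add exp_add)
    fix p assume "exp (\<Phi> p) = 1"
    then have *: "exp (Re (\<Phi> p)) * cos (Im (\<Phi> p)) = 1" "norm (exp (\<Phi> p)) = 1"
      by (simp_all flip: Re_exp)
    from *(2) have "Re (\<Phi> p) = 0" by simp
    moreover from this *(1) obtain k :: int where "Im (\<Phi> p) = of_int k * 2 * pi"
      by (auto simp: cos_one_2pi_int)
    ultimately obtain k :: int where "Re (\<Phi> p) = 0" "Im (\<Phi> p) = of_int k * 2 * pi" by blast
    \<comment> \<open>The value \<open>\<Phi> p\<close> is an integer multiple of \<open>w\<close>,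
      so its coordinates away from \<open>w\<close> vanish; those at \<open>g b n\<close> are the
      coordinates of the coefficients of \<open>p\<close>.\<close>
    then have "\<Phi> p = s (of_int k) w" by (simp add: complex_eq_iff s_def w_def)
    then have "Q.representation B (\<Phi> p) c = 0" if "c \<noteq> w" for c
      using that B by (simp add: Q.representation_scale Q.representation_basis)
    then have "Q.representation B (coeff p n) b = 0" if "b \<in> B" for b n
      using rep_\<Phi>[OF that, of p n] g[OF that, of n] by simp
    then have "Q.representation B (coeff p n) b = 0" for b n
      by (meson Q.representation_ne_zero)
    then have "coeff p n = 0" for n
      using Q.sum_nonzero_representation_eq[OF B(1), of "coeff p n"] B(2) by simp
    then show "p = 0" by (simp add: poly_eq_iff)
  qed
qed

section \<open>Characters as a module over the ring of multipliers\<close>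

text \<open>For a subgroup \<Gamma> this is a commutative ring without zero divisors that contains
  \<open>scale_stabilizer \<Gamma>\<close>. The characters form a module over it, with
  \<open>char_mult\<close> as addition and \<open>char_dilate\<close> as scalar action, so
  equivariance becomes linearity.\<close>

definition multipliers :: "complex set \<Rightarrow> complex set" where
  "multipliers \<Gamma> = {r. \<forall>\<alpha>\<in>\<Gamma>. r * \<alpha> \<in> \<Gamma>}"

lemma scale_stabilizer_multipliers: "c \<in> scale_stabilizer \<Gamma> \<Longrightarrow> c \<in> multipliers \<Gamma>"
  by (auto simp: multipliers_def scale_stabilizer_mem)

definition char_mult :: "complex set \<Rightarrow> (complex \<Rightarrow> complex) \<Rightarrow> (complex \<Rightarrow> complex) \<Rightarrow> complex \<Rightarrow> complex" where
  "char_mult \<Gamma> \<sigma> \<tau> = (\<lambda>\<alpha>\<in>\<Gamma>. \<sigma> \<alpha> * \<tau> \<alpha>)"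

definition char_dilate :: "complex set \<Rightarrow> complex \<Rightarrow> (complex \<Rightarrow> complex) \<Rightarrow> complex \<Rightarrow> complex" where
  "char_dilate \<Gamma> r \<tau> = (\<lambda>\<alpha>\<in>\<Gamma>. \<tau> (r * \<alpha>))"

lemma char_mult_assoc:
  "char_mult \<Gamma> (char_mult \<Gamma> \<rho> \<sigma>) \<tau> = char_mult \<Gamma> \<rho> (char_mult \<Gamma> \<sigma> \<tau>)"
  by (auto simp: char_mult_def fun_eq_iff)

lemma char_mult_comm: "char_mult \<Gamma> \<sigma> \<tau> = char_mult \<Gamma> \<tau> \<sigma>"
  by (auto simp: char_mult_def fun_eq_iff)

lemma char_mult_one: "\<tau> \<in> characters \<Gamma> \<Longrightarrow> char_mult \<Gamma> (\<lambda>\<alpha>\<in>\<Gamma>. 1) \<tau> = \<tau>"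
  by (auto simp: char_mult_def fun_eq_iff characters_iff extensional_def)

lemma char_dilate_1: "\<tau> \<in> characters \<Gamma> \<Longrightarrow> char_dilate \<Gamma> 1 \<tau> = \<tau>"
  by (auto simp: char_dilate_def fun_eq_iff characters_iff extensional_def)

lemma char_dilate_mult:
  "r \<in> multipliers \<Gamma> \<Longrightarrow>
    char_dilate \<Gamma> r (char_mult \<Gamma> \<sigma> \<tau>) = char_mult \<Gamma> (char_dilate \<Gamma> r \<sigma>) (char_dilate \<Gamma> r \<tau>)"
  by (auto simp: char_dilate_def char_mult_def fun_eq_iff multipliers_def)

lemma char_dilate_dilate:
  "r \<in> multipliers \<Gamma> \<Longrightarrow> char_dilate \<Gamma> r (char_dilate \<Gamma> s \<tau>) = char_dilate \<Gamma> (r * s) \<tau>"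
  by (auto simp: char_dilate_def fun_eq_iff multipliers_def mult_ac)

lemma char_dilate_add:
  "\<tau> \<in> characters \<Gamma> \<Longrightarrow> r \<in> multipliers \<Gamma> \<Longrightarrow> s \<in> multipliers \<Gamma> \<Longrightarrow>
    char_mult \<Gamma> (char_dilate \<Gamma> r \<tau>) (char_dilate \<Gamma> s \<tau>) = char_dilate \<Gamma> (r + s) \<tau>"
  by (auto simp: char_dilate_def char_mult_def fun_eq_iff multipliers_def characters_iff distrib_right)

section \<open>Extension of partial linear maps into the polynomials\<close>

text \<open>A nonempty \<open>G\<close> is the graph of a linear map from a submodule of the
  characters to the polynomials. The last clause stands for single-valuedness, and working with
  graphs lets Zorn's lemma use plain unions.\<close>

definition partial_linear :: "complex set \<Rightarrow> ((complex \<Rightarrow> complex) \<times> complex poly) set \<Rightarrow> bool" where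
  "partial_linear \<Gamma> G \<longleftrightarrow>
     (\<forall>\<tau> p. (\<tau>, p) \<in> G \<longrightarrow> \<tau> \<in> characters \<Gamma>) \<and>
     (\<forall>\<sigma> p \<tau> q. (\<sigma>, p) \<in> G \<longrightarrow> (\<tau>, q) \<in> G \<longrightarrow> (char_mult \<Gamma> \<sigma> \<tau>, p + q) \<in> G) \<and>
     (\<forall>r \<tau> p. r \<in> multipliers \<Gamma> \<longrightarrow> (\<tau>, p) \<in> G \<longrightarrow> (char_dilate \<Gamma> r \<tau>, smult r p) \<in> G) \<and>
     (\<forall>p. (\<lambda>\<alpha>\<in>\<Gamma>. 1, p) \<in> G \<longrightarrow> p = 0)"

lemma partial_linearD:
  assumes "partial_linear \<Gamma> G"
  shows "(\<tau>, p) \<in> G \<Longrightarrow> \<tau> \<in> characters \<Gamma>"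
    and "(\<sigma>, p) \<in> G \<Longrightarrow> (\<tau>, q) \<in> G \<Longrightarrow> (char_mult \<Gamma> \<sigma> \<tau>, p + q) \<in> G"
    and "(\<tau>, p) \<in> G \<Longrightarrow> r \<in> multipliers \<Gamma> \<Longrightarrow> (char_dilate \<Gamma> r \<tau>, smult r p) \<in> G"
    and "(\<lambda>\<alpha>\<in>\<Gamma>. 1, p) \<in> G \<Longrightarrow> p = 0"
  using assms unfolding partial_linear_def by blast+

lemma partial_linearI:
  assumes "\<And>\<tau> p. (\<tau>, p) \<in> G \<Longrightarrow> \<tau> \<in> characters \<Gamma>"
    and "\<And>\<sigma> p \<tau> q. (\<sigma>, p) \<in> G \<Longrightarrow> (\<tau>, q) \<in> G \<Longrightarrow> (char_mult \<Gamma> \<sigma> \<tau>, p + q) \<in> G"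
    and "\<And>r \<tau> p. r \<in> multipliers \<Gamma> \<Longrightarrow> (\<tau>, p) \<in> G \<Longrightarrow> (char_dilate \<Gamma> r \<tau>, smult r p) \<in> G"
    and "\<And>p. (\<lambda>\<alpha>\<in>\<Gamma>. 1, p) \<in> G \<Longrightarrow> p = 0"
  shows "partial_linear \<Gamma> G"
  using assms unfolding partial_linear_def by simp

context
  fixes \<Gamma> :: "complex set"
  assumes sub: "subgroup \<Gamma> complex_add_group"
begin

lemma add_mem: "\<alpha> \<in> \<Gamma> \<Longrightarrow> \<beta> \<in> \<Gamma> \<Longrightarrow> \<alpha> + \<beta> \<in> \<Gamma>"
  and zero_mem: "0 \<in> \<Gamma>"
  and minus_mem: "\<alpha> \<in> \<Gamma> \<Longrightarrow> - \<alpha> \<in> \<Gamma>"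
  using sub by (auto simp: subgroup_complex_add_group_iff)

lemma char_zero: "\<tau> \<in> characters \<Gamma> \<Longrightarrow> \<tau> 0 = 1"
  using zero_mem by (auto simp: characters_iff dest!: bspec[of _ _ 0])

lemma char_minus: "\<tau> \<in> characters \<Gamma> \<Longrightarrow> \<alpha> \<in> \<Gamma> \<Longrightarrow> \<tau> (- \<alpha>) * \<tau> \<alpha> = 1"
  using char_zero[of \<tau>] minus_mem[of \<alpha>] by (auto simp: characters_iff) (metis add.left_inverse)

lemma char_mult_closed:
  "\<sigma> \<in> characters \<Gamma> \<Longrightarrow> \<tau> \<in> characters \<Gamma> \<Longrightarrow> char_mult \<Gamma> \<sigma> \<tau> \<in> characters \<Gamma>"
  using add_mem by (auto simp: characters_iff char_mult_def)

lemma char_dilate_closed: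
  "\<tau> \<in> characters \<Gamma> \<Longrightarrow> r \<in> multipliers \<Gamma> \<Longrightarrow> char_dilate \<Gamma> r \<tau> \<in> characters \<Gamma>"
  using add_mem by (auto simp: characters_iff char_dilate_def multipliers_def distrib_left)

lemma multipliers_ring:
  "0 \<in> multipliers \<Gamma>" "1 \<in> multipliers \<Gamma>" "-1 \<in> multipliers \<Gamma>"
  "r \<in> multipliers \<Gamma> \<Longrightarrow> s \<in> multipliers \<Gamma> \<Longrightarrow> r + s \<in> multipliers \<Gamma>"
  "r \<in> multipliers \<Gamma> \<Longrightarrow> s \<in> multipliers \<Gamma> \<Longrightarrow> r * s \<in> multipliers \<Gamma>"
  using add_mem zero_mem minus_mem by (auto simp: multipliers_def distrib_right mult.assoc)

lemma char_mult_inverse: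
  "\<tau> \<in> characters \<Gamma> \<Longrightarrow> char_mult \<Gamma> (char_dilate \<Gamma> (-1) \<tau>) \<tau> = (\<lambda>\<alpha>\<in>\<Gamma>. 1)"
  by (auto simp: char_mult_def char_dilate_def fun_eq_iff char_minus)

lemma char_dilate_zero: "\<tau> \<in> characters \<Gamma> \<Longrightarrow> char_dilate \<Gamma> 0 \<tau> = (\<lambda>\<alpha>\<in>\<Gamma>. 1)"
  by (auto simp: char_dilate_def fun_eq_iff char_zero)

lemma char_mult_cancel:
  assumes "char_mult \<Gamma> \<sigma> \<tau> = (\<lambda>\<alpha>\<in>\<Gamma>. 1)" "\<sigma> \<in> characters \<Gamma>" "\<tau> \<in> characters \<Gamma>"
  shows "\<tau> = char_dilate \<Gamma> (-1) \<sigma>"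
proof -
  have "\<tau> = char_mult \<Gamma> (char_mult \<Gamma> (char_dilate \<Gamma> (-1) \<sigma>) \<sigma>) \<tau>"
    using assms by (simp add: char_mult_inverse char_mult_one)
  also have "\<dots> = char_mult \<Gamma> (\<lambda>\<alpha>\<in>\<Gamma>. 1) (char_dilate \<Gamma> (-1) \<sigma>)"
    unfolding char_mult_assoc assms(1) by (rule char_mult_comm)
  finally show ?thesis
    using assms by (simp add: char_mult_one char_dilate_closed multipliers_ring)
qed

text \<open>Subtracting two values of \<open>\<tau>\<close> gives a value of the trivial character,
  which must be 0.\<close>

lemma partial_linear_unique:
  assumes "partial_linear \<Gamma> G" "(\<tau>, p) \<in> G" "(\<tau>, q) \<in> G"
  shows "p = q"
proof -
  have "(char_dilate \<Gamma> (-1) \<tau>, smult (-1) p) \<in> G"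
    by (rule partial_linearD(3)[OF assms(1,2) multipliers_ring(3)])
  then have "(char_mult \<Gamma> (char_dilate \<Gamma> (-1) \<tau>) \<tau>, smult (-1) p + q) \<in> G"
    by (rule partial_linearD(2)[OF assms(1) _ assms(3)])
  then have "smult (-1) p + q = 0"
    using partial_linearD(4)[OF assms(1), of "smult (-1) p + q"] partial_linearD(1)[OF assms(1,2)]
    by (simp only: char_mult_inverse)
  then show ?thesis by simp
qed

text \<open>
  Adjoining one character \<open>v\<close>: the multipliers \<open>r\<close> for which \<open>r\<close> times \<open>v\<close> already has a value form
  an ideal, and since \<open>complex poly\<close> is divisible and torsion free the partial map on this ideal is
  multiplication by a fixed polynomial \<open>m\<close>.
\<close>

lemma partial_linear_extend:
  assumes G: "partial_linear \<Gamma> G" and one: "(\<lambda>\<alpha>\<in>\<Gamma>. 1, 0) \<in> G" and v: "v \<in> characters \<Gamma>"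
  obtains G' p where "partial_linear \<Gamma> G'" "G \<subseteq> G'" "(v, p) \<in> G'"
proof -
  note chars = partial_linearD(1)[OF G] and mult = partial_linearD(2)[OF G]
    and dilate = partial_linearD(3)[OF G]
  obtain m where m: "\<And>r p. r \<in> multipliers \<Gamma> \<Longrightarrow> (char_dilate \<Gamma> r v, p) \<in> G \<Longrightarrow> p = smult r m"
  proof (cases "\<exists>a q. a \<in> multipliers \<Gamma> \<and> a \<noteq> 0 \<and> (char_dilate \<Gamma> a v, q) \<in> G")
    \<comment> \<open>The value \<open>q\<close> of \<open>a\<close> times \<open>v\<close> forces
      \<open>m\<close> to be \<open>q\<close> divided by \<open>a\<close>; evaluating
      \<open>a * r\<close> times \<open>v\<close> in two ways shows that this fits every
      \<open>r\<close>.\<close>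
    case True
    then obtain a q where a: "a \<in> multipliers \<Gamma>" "a \<noteq> 0" "(char_dilate \<Gamma> a v, q) \<in> G" by blast
    show thesis
    proof (rule that[of "smult (inverse a) q"])
      fix r p assume r: "r \<in> multipliers \<Gamma>" "(char_dilate \<Gamma> r v, p) \<in> G"
      have "(char_dilate \<Gamma> (a * r) v, smult a p) \<in> G" "(char_dilate \<Gamma> (a * r) v, smult r q) \<in> G"
        using dilate[OF r(2) a(1)] dilate[OF a(3) r(1)] a(1) r(1)
        by (simp_all add: char_dilate_dilate mult.commute)
      then have "smult a p = smult r q" by (rule partial_linear_unique[OF G])
      then have "smult (inverse a) (smult a p) = smult (inverse a) (smult r q)" by simp
      then show "p = smult r (smult (inverse a) q)" using a(2) by (simp add: mult.commute)
    qed
  next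
    \<comment> \<open>No nonzero multiple of \<open>v\<close> has a value yet, so every choice of
      \<open>m\<close> is consistent.\<close>
    case False
    show thesis
    proof (rule that[of 0])
      fix r p assume r: "r \<in> multipliers \<Gamma>" "(char_dilate \<Gamma> r v, p) \<in> G"
      then have "r = 0" using False by blast
      then show "p = smult r 0" using r(2) v partial_linearD(4)[OF G] by (simp add: char_dilate_zero)
    qed
  qed
  define G' where
    "G' = {(char_mult \<Gamma> \<tau> (char_dilate \<Gamma> r v), p + smult r m) | \<tau> p r. (\<tau>, p) \<in> G \<and> r \<in> multipliers \<Gamma>}"
  have G'I: "(char_mult \<Gamma> \<tau> (char_dilate \<Gamma> r v), p + smult r m) \<in> G'"
    if "(\<tau>, p) \<in> G" "r \<in> multipliers \<Gamma>" for \<tau> p r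
    using that unfolding G'_def by blast
  show thesis
  proof (rule that[of G' m])
    show "(v, m) \<in> G'"
      using G'I[OF one, of 1] v by (simp add: multipliers_ring char_mult_one char_dilate_1)
    show "G \<subseteq> G'"
    proof (rule subrelI)
      fix \<tau> p assume "(\<tau>, p) \<in> G"
      then show "(\<tau>, p) \<in> G'"
        using G'I[of \<tau> p 0] chars[of \<tau> p] v
        by (simp add: multipliers_ring char_dilate_zero char_mult_comm[of _ \<tau>] char_mult_one)
    qed
    show "partial_linear \<Gamma> G'"
    proof (rule partial_linearI)
      show "\<tau> \<in> characters \<Gamma>" if "(\<tau>, p) \<in> G'" for \<tau> p
        using that chars v by (auto simp: G'_def char_mult_closed char_dilate_closed)
    next
      fix \<sigma>' p' \<tau>' q' assume "(\<sigma>', p') \<in> G'" "(\<tau>', q') \<in> G'"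
      then obtain \<sigma> p r \<tau> q s
        where x: "\<sigma>' = char_mult \<Gamma> \<sigma> (char_dilate \<Gamma> r v)" "p' = p + smult r m"
          "(\<sigma>, p) \<in> G" "r \<in> multipliers \<Gamma>"
        and y: "\<tau>' = char_mult \<Gamma> \<tau> (char_dilate \<Gamma> s v)" "q' = q + smult s m"
          "(\<tau>, q) \<in> G" "s \<in> multipliers \<Gamma>"
        unfolding G'_def by blast
      have "char_mult \<Gamma> \<sigma>' \<tau>' = char_mult \<Gamma> (char_mult \<Gamma> \<sigma> \<tau>) (char_dilate \<Gamma> (r + s) v)"
        unfolding char_dilate_add[OF v x(4) y(4), symmetric] x(1) y(1)
        by (auto simp: char_mult_def fun_eq_iff)
      then show "(char_mult \<Gamma> \<sigma>' \<tau>', p' + q') \<in> G'"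
        using G'I[OF mult[OF x(3) y(3)] multipliers_ring(4)[OF x(4) y(4)]]
        by (simp add: x(2) y(2) smult_add_left add_ac)
    next
      fix r \<tau>' p' assume r: "r \<in> multipliers \<Gamma>" and "(\<tau>', p') \<in> G'"
      then obtain \<tau> q s where x: "\<tau>' = char_mult \<Gamma> \<tau> (char_dilate \<Gamma> s v)" "p' = q + smult s m"
        "(\<tau>, q) \<in> G" "s \<in> multipliers \<Gamma>"
        unfolding G'_def by blast
      show "(char_dilate \<Gamma> r \<tau>', smult r p') \<in> G'"
        using G'I[OF dilate[OF x(3) r] multipliers_ring(5)[OF r x(4)]] r
        by (simp add: x(1,2) char_dilate_mult char_dilate_dilate smult_add_right)
    next
      fix p assume "(\<lambda>\<alpha>\<in>\<Gamma>. 1, p) \<in> G'"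
      then obtain \<tau> q s
        where "(\<lambda>\<alpha>\<in>\<Gamma>. 1, p) = (char_mult \<Gamma> \<tau> (char_dilate \<Gamma> s v), q + smult s m)"
          and "(\<tau>, q) \<in> G" "s \<in> multipliers \<Gamma>"
        unfolding G'_def by blast
      then have x: "char_mult \<Gamma> \<tau> (char_dilate \<Gamma> s v) = (\<lambda>\<alpha>\<in>\<Gamma>. 1)" "p = q + smult s m"
        "(\<tau>, q) \<in> G" "s \<in> multipliers \<Gamma>"
        by (simp_all del: restrict_apply)
      \<comment> \<open>If \<open>\<tau>\<close> and \<open>s\<close> times \<open>v\<close> cancel,
        then \<open>s\<close> times \<open>v\<close> already has the value \<open>- q\<close>, which
        is \<open>smult s m\<close> by the choice of \<open>m\<close>.\<close>
      have "char_dilate \<Gamma> s v = char_dilate \<Gamma> (-1) \<tau>"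
        using char_mult_cancel[OF x(1)] chars[OF x(3)] char_dilate_closed[OF v x(4)] by simp
      then have "(char_dilate \<Gamma> s v, smult (-1) q) \<in> G"
        using dilate[OF x(3) multipliers_ring(3)] by simp
      then have "smult (-1) q = smult s m" by (rule m[OF x(4)])
      then show "p = 0" by (simp add: x(2) flip: \<open>smult (-1) q = smult s m\<close>)
    qed
  qed
qed

text \<open>Zorn's lemma: a maximal partial linear map above \<open>G0\<close> is total, since
  \<open>partial_linear_extend\<close> would adjoin any missing character.\<close>

lemma partial_linear_total:
  assumes G0: "partial_linear \<Gamma> G0" "(\<lambda>\<alpha>\<in>\<Gamma>. 1, 0) \<in> G0"
  obtains G where "partial_linear \<Gamma> G" "G0 \<subseteq> G" "fst ` G = characters \<Gamma>"
proof -
  let ?A = "{G. partial_linear \<Gamma> G \<and> G0 \<subseteq> G}"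
  have "\<exists>M\<in>?A. \<forall>X\<in>?A. M \<subseteq> X \<longrightarrow> X = M"
  proof (rule subset_Zorn_nonempty)
    show "?A \<noteq> {}" using G0 by blast
    fix C assume C: "C \<noteq> {}" "subset.chain ?A C"
    have pl: "partial_linear \<Gamma> G" if "G \<in> C" for G
      using C that by (auto simp: subset.chain_def)
    \<comment> \<open>Closure under \<open>char_mult\<close> involves two pairs, which need a common
      member of the chain.\<close>
    have two: "\<exists>G\<in>C. x \<in> G \<and> y \<in> G" if xy: "x \<in> \<Union>C" "y \<in> \<Union>C" for x y
    proof -
      obtain X Y where "X \<in> C" "Y \<in> C" "x \<in> X" "y \<in> Y" using xy by blast
      moreover have "X \<subseteq> Y \<or> Y \<subseteq> X"
        using C(2) calculation(1,2) by (auto simp: subset_chain_def)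
      ultimately show ?thesis by blast
    qed
    have "partial_linear \<Gamma> (\<Union>C)"
    proof (rule partial_linearI)
      fix \<sigma> p \<tau> q assume "(\<sigma>, p) \<in> \<Union>C" "(\<tau>, q) \<in> \<Union>C"
      then obtain G where "G \<in> C" "(\<sigma>, p) \<in> G" "(\<tau>, q) \<in> G" using two by blast
      then show "(char_mult \<Gamma> \<sigma> \<tau>, p + q) \<in> \<Union>C"
        using partial_linearD(2)[OF pl] by blast
    qed (use partial_linearD(1,3,4)[OF pl] in blast)+
    moreover have "G0 \<subseteq> \<Union>C"
    proof -
      obtain X where "X \<in> C" using C(1) by blast
      moreover from this have "G0 \<subseteq> X" using C(2) by (auto simp: subset_chain_def)
      ultimately show ?thesis by blast
    qed
    ultimately show "\<Union>C \<in> ?A" by blast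
  qed
  then obtain G where "G \<in> ?A" and max: "\<forall>X\<in>?A. G \<subseteq> X \<longrightarrow> X = G" by (rule bexE)
  then have G: "partial_linear \<Gamma> G" "G0 \<subseteq> G" by simp_all
  have "v \<in> fst ` G" if v: "v \<in> characters \<Gamma>" for v
  proof -
    have one: "(\<lambda>\<alpha>\<in>\<Gamma>. 1, 0) \<in> G" using G(2) G0(2) by (rule subsetD)
    obtain G' p where G': "partial_linear \<Gamma> G'" "G \<subseteq> G'" "(v, p) \<in> G'"
      by (rule partial_linear_extend[OF G(1) one v])
    have "G' = G" using G' G(2) by (intro max[rule_format]) auto
    then have "(v, p) \<in> G" using G'(3) by simp
    then show ?thesis by (intro image_eqI[of _ _ "(v, p)"]) simp_all
  qed
  moreover have "fst ` G \<subseteq> characters \<Gamma>" using partial_linearD(1)[OF G(1)] by auto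
  ultimately show thesis using that G by blast
qed

text \<open>\<open>j\<close> embeds the polynomials linearly into the characters: it is injective
  because \<open>e\<close> has trivial kernel and \<Gamma> has a nonzero element. The retraction
  \<open>P\<close> is a total extension of the inverse of \<open>j\<close>.\<close>

lemma exists_retraction:
  fixes e :: "complex poly \<Rightarrow> complex"
  assumes nontriv: "\<Gamma> \<noteq> {0}"
    and e_add: "\<And>p q. e (p + q) = e p * e q"
    and e_inj: "\<And>p. e p = 1 \<longleftrightarrow> p = 0"
    and j_def: "j = (\<lambda>p. \<lambda>\<alpha>\<in>\<Gamma>. e (smult \<alpha> p))"
  shows "j p \<in> characters \<Gamma>" and "j (p + q) = char_mult \<Gamma> (j p) (j q)"
    and "r \<in> multipliers \<Gamma> \<Longrightarrow> j (smult r p) = char_dilate \<Gamma> r (j p)"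
    and "j 0 = (\<lambda>\<alpha>\<in>\<Gamma>. 1)"
    and "\<exists>P. (\<forall>p. P (j p) = p) \<and>
      (\<forall>\<sigma>\<in>characters \<Gamma>. \<forall>\<tau>\<in>characters \<Gamma>. P (char_mult \<Gamma> \<sigma> \<tau>) = P \<sigma> + P \<tau>) \<and>
      (\<forall>r\<in>multipliers \<Gamma>. \<forall>\<tau>\<in>characters \<Gamma>. P (char_dilate \<Gamma> r \<tau>) = smult r (P \<tau>))"
proof -
  obtain \<gamma> where \<gamma>: "\<gamma> \<in> \<Gamma>" "\<gamma> \<noteq> 0" using nontriv zero_mem by blast
  have e_0: "e 0 = 1" using e_inj by blast
  have e_neq: "e p \<noteq> 0" for p
  proof
    assume "e p = 0"
    then show False using e_add[of p "- p"] e_0 by simp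
  qed
  have j_char: "j p \<in> characters \<Gamma>" for p
    using add_mem by (auto simp: j_def characters_iff e_neq e_add smult_add_left)
  have j_add: "j (p + q) = char_mult \<Gamma> (j p) (j q)" for p q
    by (auto simp: j_def char_mult_def fun_eq_iff e_add smult_add_right)
  have j_smult: "j (smult r p) = char_dilate \<Gamma> r (j p)" if "r \<in> multipliers \<Gamma>" for r p
    using that by (auto simp: j_def char_dilate_def fun_eq_iff multipliers_def mult.commute)
  have j_0: "j 0 = (\<lambda>\<alpha>\<in>\<Gamma>. 1)" by (auto simp: j_def e_0)
  have j_inj: "p = 0" if "j p = (\<lambda>\<alpha>\<in>\<Gamma>. 1)" for p
  proof -
    have "e (smult \<gamma> p) = 1" using fun_cong[OF that, of \<gamma>] \<gamma> by (simp add: j_def)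
    then show ?thesis using \<gamma> by (simp add: e_inj)
  qed
  define G0 where "G0 = range (\<lambda>p. (j p, p))"
  have "partial_linear \<Gamma> G0"
  proof (rule partial_linearI)
    show "(char_mult \<Gamma> \<sigma> \<tau>, p + q) \<in> G0" if "(\<sigma>, p) \<in> G0" "(\<tau>, q) \<in> G0" for \<sigma> p \<tau> q
      using that by (auto simp: G0_def simp flip: j_add)
    show "(char_dilate \<Gamma> r \<tau>, smult r p) \<in> G0" if "r \<in> multipliers \<Gamma>" "(\<tau>, p) \<in> G0" for r \<tau> p
      using that by (auto simp: G0_def simp flip: j_smult)
    show "p = 0" if "(\<lambda>\<alpha>\<in>\<Gamma>. 1, p) \<in> G0" for p
    proof -
      have "j p = (\<lambda>\<alpha>\<in>\<Gamma>. 1)" using that by (auto simp: G0_def)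
      then show ?thesis by (rule j_inj)
    qed
  qed (auto simp: G0_def j_char)
  moreover have "(\<lambda>\<alpha>\<in>\<Gamma>. 1, 0) \<in> G0" using j_0 by (force simp: G0_def)
  ultimately obtain G where G: "partial_linear \<Gamma> G" "G0 \<subseteq> G" "fst ` G = characters \<Gamma>"
    by (rule partial_linear_total)
  define P where "P = (\<lambda>\<tau>. SOME p. (\<tau>, p) \<in> G)"
  have P: "(\<tau>, P \<tau>) \<in> G" if "\<tau> \<in> characters \<Gamma>" for \<tau>
  proof -
    have "\<exists>p. (\<tau>, p) \<in> G" using that G(3) by force
    then show ?thesis unfolding P_def by (rule someI_ex)
  qed
  have P_eq: "P \<tau> = p" if "(\<tau>, p) \<in> G" for \<tau> p
  proof -
    have "\<tau> \<in> characters \<Gamma>" using that G(3) by force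
    from partial_linear_unique[OF G(1) P[OF this] that] show ?thesis .
  qed
  show "\<exists>P. (\<forall>p. P (j p) = p) \<and>
      (\<forall>\<sigma>\<in>characters \<Gamma>. \<forall>\<tau>\<in>characters \<Gamma>. P (char_mult \<Gamma> \<sigma> \<tau>) = P \<sigma> + P \<tau>) \<and>
      (\<forall>r\<in>multipliers \<Gamma>. \<forall>\<tau>\<in>characters \<Gamma>. P (char_dilate \<Gamma> r \<tau>) = smult r (P \<tau>))"
  proof (intro exI[of _ P] conjI ballI allI)
    show "P (char_mult \<Gamma> \<sigma> \<tau>) = P \<sigma> + P \<tau>" if "\<sigma> \<in> characters \<Gamma>" "\<tau> \<in> characters \<Gamma>" for \<sigma> \<tau>
      by (intro P_eq partial_linearD(2)[OF G(1)] P that)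
    show "P (char_dilate \<Gamma> r \<tau>) = smult r (P \<tau>)"
      if "r \<in> multipliers \<Gamma>" "\<tau> \<in> characters \<Gamma>" for r \<tau>
      by (intro P_eq partial_linearD(3)[OF G(1)] P that)
    show "P (j p) = p" for p using G(2) by (intro P_eq) (auto simp: G0_def)
  qed
  show "j p \<in> characters \<Gamma>" "j (p + q) = char_mult \<Gamma> (j p) (j q)" "j 0 = (\<lambda>\<alpha>\<in>\<Gamma>. 1)"
    by (fact j_char j_add j_0)+
  show "j (smult r p) = char_dilate \<Gamma> r (j p)" if "r \<in> multipliers \<Gamma>"
    using that by (rule j_smult)
qed

text \<open>
  An Eilenberg swindle: \<open>characters \<Gamma>\<close> splits off a copy of \<open>complex poly\<close>, which absorbs one more
  coordinate by shifting coefficients.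
\<close>

lemma characters_absorb_complex:
  assumes nontriv: "\<Gamma> \<noteq> {0}"
  obtains \<theta> :: "(complex \<Rightarrow> complex) \<Rightarrow> (complex \<Rightarrow> complex)" and \<beta> :: "(complex \<Rightarrow> complex) \<Rightarrow> complex"
  where "bij_betw (\<lambda>\<tau>. (\<theta> \<tau>, \<beta> \<tau>)) (characters \<Gamma>) (characters \<Gamma> \<times> UNIV)"
    and "\<And>\<sigma> \<tau>. \<sigma> \<in> characters \<Gamma> \<Longrightarrow> \<tau> \<in> characters \<Gamma> \<Longrightarrow>
      \<theta> (char_mult \<Gamma> \<sigma> \<tau>) = char_mult \<Gamma> (\<theta> \<sigma>) (\<theta> \<tau>)"
    and "\<And>\<sigma> \<tau>. \<sigma> \<in> characters \<Gamma> \<Longrightarrow> \<tau> \<in> characters \<Gamma> \<Longrightarrow> \<beta> (char_mult \<Gamma> \<sigma> \<tau>) = \<beta> \<sigma> + \<beta> \<tau>"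
    and "\<And>r \<tau>. r \<in> multipliers \<Gamma> \<Longrightarrow> \<tau> \<in> characters \<Gamma> \<Longrightarrow>
      \<theta> (char_dilate \<Gamma> r \<tau>) = char_dilate \<Gamma> r (\<theta> \<tau>)"
    and "\<And>r \<tau>. r \<in> multipliers \<Gamma> \<Longrightarrow> \<tau> \<in> characters \<Gamma> \<Longrightarrow> \<beta> (char_dilate \<Gamma> r \<tau>) = r * \<beta> \<tau>"
proof -
  obtain e :: "complex poly \<Rightarrow> complex"
    where e: "\<And>p q. e (p + q) = e p * e q" "\<And>p. e p = 1 \<longleftrightarrow> p = 0"
    using exists_poly_embedding by blast
  define j where "j = (\<lambda>p. \<lambda>\<alpha>\<in>\<Gamma>. e (smult \<alpha> p))"
  note j_char = exists_retraction(1)[OF nontriv e j_def]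
    and j_add = exists_retraction(2)[OF nontriv e j_def]
    and j_smult = exists_retraction(3)[OF nontriv e j_def]
    and j_0 = exists_retraction(4)[OF nontriv e j_def]
  obtain P :: "(complex \<Rightarrow> complex) \<Rightarrow> complex poly" where P_j: "\<And>p. P (j p) = p"
    and P_mult: "\<And>\<sigma> \<tau>. \<sigma> \<in> characters \<Gamma> \<Longrightarrow> \<tau> \<in> characters \<Gamma> \<Longrightarrow> P (char_mult \<Gamma> \<sigma> \<tau>) = P \<sigma> + P \<tau>"
    and P_dilate: "\<And>r \<tau>. r \<in> multipliers \<Gamma> \<Longrightarrow> \<tau> \<in> characters \<Gamma> \<Longrightarrow> P (char_dilate \<Gamma> r \<tau>) = smult r (P \<tau>)"
    using exists_retraction(5)[OF nontriv e j_def] by blast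
  have [simp]: "poly_shift (Suc 0) (p + q) = poly_shift (Suc 0) p + poly_shift (Suc 0) q"
    "poly_shift (Suc 0) (smult c p) = smult c (poly_shift (Suc 0) p)"
    "poly_shift (Suc 0) (pCons c p) = p" for c and p q :: "complex poly"
    by (simp_all add: poly_eq_iff coeff_poly_shift)
  have pCons_shift: "pCons (coeff p 0) (poly_shift (Suc 0) p) = p" for p :: "complex poly"
    by (auto simp: poly_eq_iff coeff_poly_shift coeff_pCons split: nat.split)
  \<comment> \<open>Only the polynomial component \<open>P \<tau>\<close> changes:
    \<open>\<theta>\<close> drops its constant coefficient, kept as \<open>\<beta> \<tau>\<close>,
    and lowers the other degrees by one; \<open>\<psi>\<close> undoes this.\<close>
  define \<theta> where "\<theta> = (\<lambda>\<tau>. char_mult \<Gamma> \<tau> (j (poly_shift (Suc 0) (P \<tau>) - P \<tau>)))"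
  define \<beta> where "\<beta> = (\<lambda>\<tau>. coeff (P \<tau>) 0)"
  define \<psi> where "\<psi> = (\<lambda>(\<tau>, b). char_mult \<Gamma> \<tau> (j (pCons b (P \<tau>) - P \<tau>)))"
  have j_j: "char_mult \<Gamma> (char_mult \<Gamma> \<tau> (j p)) (j q) = char_mult \<Gamma> \<tau> (j (p + q))" for \<tau> p q
    by (simp add: char_mult_assoc j_add)
  have j_0': "char_mult \<Gamma> \<tau> (j 0) = \<tau>" if "\<tau> \<in> characters \<Gamma>" for \<tau>
    using that by (simp add: j_0 char_mult_one char_mult_comm[of _ \<tau>])
  have \<theta>_char: "\<theta> \<tau> \<in> characters \<Gamma>" if "\<tau> \<in> characters \<Gamma>" for \<tau>
    using that by (simp add: \<theta>_def char_mult_closed j_char)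
  show thesis
  proof (rule that[of \<theta> \<beta>])
    show "bij_betw (\<lambda>\<tau>. (\<theta> \<tau>, \<beta> \<tau>)) (characters \<Gamma>) (characters \<Gamma> \<times> UNIV)"
    proof (rule bij_betw_byWitness[of _ \<psi>])
      show "\<forall>\<tau>\<in>characters \<Gamma>. \<psi> (\<theta> \<tau>, \<beta> \<tau>) = \<tau>"
      proof
        fix \<tau> assume \<tau>: "\<tau> \<in> characters \<Gamma>"
        then have "P (\<theta> \<tau>) = poly_shift (Suc 0) (P \<tau>)" by (simp add: \<theta>_def P_mult j_char P_j)
        then have "\<psi> (\<theta> \<tau>, \<beta> \<tau>) = char_mult \<Gamma> (\<theta> \<tau>) (j (P \<tau> - poly_shift (Suc 0) (P \<tau>)))"
          using pCons_shift[of "P \<tau>"] by (simp add: \<psi>_def \<beta>_def)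
        then show "\<psi> (\<theta> \<tau>, \<beta> \<tau>) = \<tau>" using \<tau> by (simp add: \<theta>_def j_j j_0')
      qed
      show "\<forall>x\<in>characters \<Gamma> \<times> UNIV. (\<theta> (\<psi> x), \<beta> (\<psi> x)) = x"
      proof
        fix x :: "(complex \<Rightarrow> complex) \<times> complex" assume "x \<in> characters \<Gamma> \<times> UNIV"
        then obtain \<tau> b where x: "x = (\<tau>, b)" and \<tau>: "\<tau> \<in> characters \<Gamma>" by blast
        have P: "P (\<psi> x) = pCons b (P \<tau>)" using \<tau> by (simp add: x \<psi>_def P_mult j_char P_j)
        have "\<theta> (\<psi> x) = char_mult \<Gamma> (\<psi> x) (j (P \<tau> - pCons b (P \<tau>)))"
          unfolding \<theta>_def P by simp
        then show "(\<theta> (\<psi> x), \<beta> (\<psi> x)) = x"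
          using \<tau> P by (simp add: x \<psi>_def j_j j_0' \<beta>_def)
      qed
    qed (auto simp: \<theta>_char \<psi>_def char_mult_closed j_char)
  next
    fix \<sigma> \<tau> assume *: "\<sigma> \<in> characters \<Gamma>" "\<tau> \<in> characters \<Gamma>"
    show "\<beta> (char_mult \<Gamma> \<sigma> \<tau>) = \<beta> \<sigma> + \<beta> \<tau>"
      using * by (simp add: \<beta>_def P_mult)
    have "\<theta> (char_mult \<Gamma> \<sigma> \<tau>) = char_mult \<Gamma> (char_mult \<Gamma> \<sigma> \<tau>)
        (j ((poly_shift (Suc 0) (P \<sigma>) - P \<sigma>) + (poly_shift (Suc 0) (P \<tau>) - P \<tau>)))"
      using * by (simp add: \<theta>_def P_mult algebra_simps)
    then show "\<theta> (char_mult \<Gamma> \<sigma> \<tau>) = char_mult \<Gamma> (\<theta> \<sigma>) (\<theta> \<tau>)"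
      unfolding j_add by (auto simp: \<theta>_def char_mult_def fun_eq_iff)
  next
    fix r \<tau> assume r: "r \<in> multipliers \<Gamma>" and \<tau>: "\<tau> \<in> characters \<Gamma>"
    show "\<beta> (char_dilate \<Gamma> r \<tau>) = r * \<beta> \<tau>" using r \<tau> by (simp add: \<beta>_def P_dilate)
    show "\<theta> (char_dilate \<Gamma> r \<tau>) = char_dilate \<Gamma> r (\<theta> \<tau>)"
      using r \<tau> by (simp add: \<theta>_def P_dilate char_dilate_mult flip: j_smult smult_diff_right)
  qed
qed

end

section \<open>The automorphisms of \<open>W\<close>\<close>

lemma W_single: "\<alpha> \<in> \<Gamma> \<Longrightarrow> Poly_Mapping.single (\<alpha>, i) a \<in> W \<Gamma>"
  by (simp add: W_def)

lemma W_L: "\<alpha> \<in> \<Gamma> \<Longrightarrow> L \<alpha> i \<in> W \<Gamma>"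
  by (simp add: L_def W_single)

lemma W_induct [consumes 1, case_names zero add]:
  assumes "x \<in> W \<Gamma>" "P 0"
    and "\<And>\<alpha> i a x. \<alpha> \<in> \<Gamma> \<Longrightarrow> x \<in> W \<Gamma> \<Longrightarrow> P x \<Longrightarrow> P (Poly_Mapping.single (\<alpha>, i) a + x)"
  shows "P x"
proof -
  have "A \<subseteq> \<Gamma> \<times> UNIV \<Longrightarrow> P (\<Sum>k\<in>A. Poly_Mapping.single k (Poly_Mapping.lookup x k)) \<and>
      (\<Sum>k\<in>A. Poly_Mapping.single k (Poly_Mapping.lookup x k)) \<in> W \<Gamma>" for A
  proof (induction A rule: infinite_finite_induct)
    case (insert k A)
    then show ?case using assms(3) by (cases k) (simp add: W_add W_single)
  qed (simp_all add: assms(2), simp_all add: W_def)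
  from this[of "Poly_Mapping.keys x"] assms(1) show ?thesis
    by (simp add: W_def sum_single_lookup)
qed

abbreviation const :: "complex \<Rightarrow> (complex \<times> nat \<Rightarrow>\<^sub>0 complex)" where
  "const a \<equiv> Poly_Mapping.single 0 a"

lemma const_mult: "const (a * b) = const a * const b"
  by (simp add: mult_single)

lemma der_const [simp]: "der (const a) = 0"
  using der_single[of 0 0 a] by (simp add: zero_prod_def)

lemma der_1 [simp]: "der 1 = 0"
  using der_const[of 1] by simp

lemma der_const_mult: "der (const a * x) = const a * der x"
  by (simp add: der_mult)

lemma der_diff: "der (x - y) = der x - der y"
  using der_add[of "x - y" y] by simp

lemma der_power: "der (x ^ i) = of_nat i * x ^ (i - 1) * der x"
proof (induction i)
  case 0
  show ?case using der_const[of 1] by simp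
next
  case (Suc i)
  then show ?case by (cases i) (simp_all add: der_mult algebra_simps)
qed

lemma lookup_der: "Poly_Mapping.lookup (der x) (\<alpha>, i) =
  \<alpha> * Poly_Mapping.lookup x (\<alpha>, i) + of_nat (Suc i) * Poly_Mapping.lookup x (\<alpha>, Suc i)"
proof (induction x rule: pm_add_induct)
  case (add k a x)
  have "Poly_Mapping.lookup (der (Poly_Mapping.single k a)) (\<alpha>, i) =
    \<alpha> * Poly_Mapping.lookup (Poly_Mapping.single k a) (\<alpha>, i) +
    of_nat (Suc i) * Poly_Mapping.lookup (Poly_Mapping.single k a) (\<alpha>, Suc i)"
    by (cases k; cases "snd k") (auto simp: der_single lookup_add lookup_single when_def)
  then show ?case using add by (simp add: der_add lookup_add algebra_simps)
qed simp

text \<open>The coefficient at \<open>(\<alpha>, Suc i)\<close> is the one at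
  \<open>(\<alpha>, i)\<close> times \<open>(c - \<alpha>) / Suc i\<close>. For
  \<open>\<alpha> \<noteq> c\<close> a nonzero coefficient would propagate upward for ever, against
  finite support; for \<open>\<alpha> = c\<close> only index 0 survives.\<close>

lemma der_eigenvector:
  assumes "der x = scale c x"
  shows "x = Poly_Mapping.single (c, 0) (Poly_Mapping.lookup x (c, 0))"
proof -
  have eq: "\<alpha> * Poly_Mapping.lookup x (\<alpha>, i) + of_nat (Suc i) * Poly_Mapping.lookup x (\<alpha>, Suc i)
      = c * Poly_Mapping.lookup x (\<alpha>, i)" for \<alpha> i
    unfolding lookup_der[symmetric] assms by simp
  have "Poly_Mapping.lookup x (\<alpha>, i) = 0" if "\<alpha> \<noteq> c" for \<alpha> i
  proof (rule ccontr)
    assume i: "Poly_Mapping.lookup x (\<alpha>, i) \<noteq> 0"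
    have step: "Poly_Mapping.lookup x (\<alpha>, Suc j) \<noteq> 0" if "Poly_Mapping.lookup x (\<alpha>, j) \<noteq> 0" for j
      using eq[of \<alpha> j] that \<open>\<alpha> \<noteq> c\<close> by auto
    have "Poly_Mapping.lookup x (\<alpha>, i + n) \<noteq> 0" for n
      by (induction n) (simp_all add: i step)
    then have "range (\<lambda>n. (\<alpha>, i + n)) \<subseteq> Poly_Mapping.keys x"
      by (auto simp: in_keys_iff)
    moreover have "infinite (range (\<lambda>n. (\<alpha>, i + n)))"
      by (rule range_inj_infinite) (simp add: inj_def)
    ultimately show False using finite_subset[OF _ finite_keys] by blast
  qed
  moreover have "Poly_Mapping.lookup x (c, Suc i) = 0" for i
    using eq[of c i] by (simp del: of_nat_Suc)
  ultimately have "Poly_Mapping.lookup x k = (Poly_Mapping.lookup x (c, 0) when (c, 0) = k)" for k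
    by (cases k; cases "snd k"; cases "fst k = c") auto
  then show ?thesis unfolding lookup_single[symmetric] by (rule poly_mapping_eqI)
qed

section \<open>Affine substitutions twisted by characters\<close>

text \<open>The image of \<open>t^i e^(\<alpha>t)\<close> under \<open>t \<mapsto> c t + b\<close>,
  except that the factor \<open>e^(\<alpha>b)\<close> of the literal substitution is replaced by
  \<open>\<tau> \<alpha>\<close>; of that factor only multiplicativity in \<alpha> matters.\<close>

definition monom_image ::
  "(complex \<Rightarrow> complex) \<Rightarrow> complex \<Rightarrow> complex \<Rightarrow> complex \<times> nat \<Rightarrow> (complex \<times> nat \<Rightarrow>\<^sub>0 complex)" where
  "monom_image \<tau> b c k = Poly_Mapping.single (c * fst k, 0) (\<tau> (fst k)) *
     (Poly_Mapping.single (0, 1) c + const b) ^ snd k"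

definition subst ::
  "(complex \<Rightarrow> complex) \<Rightarrow> complex \<Rightarrow> complex \<Rightarrow> (complex \<times> nat \<Rightarrow>\<^sub>0 complex) \<Rightarrow> (complex \<times> nat \<Rightarrow>\<^sub>0 complex)" where
  "subst \<tau> b c x = (\<Sum>k\<in>Poly_Mapping.keys x. const (Poly_Mapping.lookup x k) * monom_image \<tau> b c k)"

lemma subst_0 [simp]: "subst \<tau> b c 0 = 0"
  by (simp add: subst_def)

lemma subst_single: "subst \<tau> b c (Poly_Mapping.single k a) = const a * monom_image \<tau> b c k"
  by (cases "a = 0") (simp_all add: subst_def)

lemma subst_add: "subst \<tau> b c (x + y) = subst \<tau> b c x + subst \<tau> b c y"
proof -
  let ?A = "Poly_Mapping.keys x \<union> Poly_Mapping.keys y"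
  have "subst \<tau> b c z = (\<Sum>k\<in>?A. const (Poly_Mapping.lookup z k) * monom_image \<tau> b c k)"
    if "Poly_Mapping.keys z \<subseteq> ?A" for z
    unfolding subst_def using that
    by (intro sum_keys_superset[where f = "\<lambda>k a. const a * monom_image \<tau> b c k"]) auto
  from this[of x] this[of y] this[OF Poly_Mapping.keys_add[of x y]] show ?thesis
    by (simp add: lookup_add single_add distrib_right sum.distrib)
qed

lemma subst_diff: "subst \<tau> b c (x - y) = subst \<tau> b c x - subst \<tau> b c y"
  using subst_add[of \<tau> b c "x - y" y] by simp

lemma subst_const_mult: "subst \<tau> b c (const a * x) = const a * subst \<tau> b c x"
proof (induction x rule: pm_add_induct)
  case (add k d x)
  then show ?case
    using subst_single[of \<tau> b c k "a * d"]
    by (simp add: distrib_left subst_add subst_single mult_single flip: mult.assoc)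
qed simp

text \<open>Chain rule: the exponential is an eigenvector with eigenvalue
  \<open>c * \<alpha>\<close>, and the inner function has derivative \<open>c\<close>. For
  \<open>i = 0\<close> the truncated index \<open>i - 1\<close> comes with coefficient 0.\<close>

lemma der_monom_image:
  "der (monom_image \<tau> b c (\<alpha>, i)) =
    const c * (const \<alpha> * monom_image \<tau> b c (\<alpha>, i) + const (of_nat i) * monom_image \<tau> b c (\<alpha>, i - 1))"
proof -
  define e where "e = Poly_Mapping.single (c * \<alpha>, 0 :: nat) (\<tau> \<alpha>)"
  define u where "u = Poly_Mapping.single (0, 1) c + const b"
  have e: "der e = const c * const \<alpha> * e"
    by (simp add: e_def der_single mult_single mult.commute)
  have u: "der u = const c"
    by (simp add: u_def der_add der_single zero_prod_def)
  have "der (e * u ^ i) = const c * (const \<alpha> * (e * u ^ i) + const (of_nat i) * (e * u ^ (i - 1)))"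
    by (simp add: der_mult der_power e u single_of_nat algebra_simps)
  then show ?thesis by (simp add: monom_image_def e_def u_def)
qed

lemma der_subst: "der (subst \<tau> b c x) = const c * subst \<tau> b c (der x)"
proof (induction x rule: pm_add_induct)
  case (add k a x)
  obtain \<alpha> i where k: "k = (\<alpha>, i)" by fastforce
  have "der (subst \<tau> b c (Poly_Mapping.single k a)) = const c * subst \<tau> b c (der (Poly_Mapping.single k a))"
    by (simp add: k subst_single der_const_mult der_monom_image der_single subst_add const_mult algebra_simps)
  then show ?case using add by (simp add: subst_add der_add distrib_left)
qed simp

text \<open>Unlike \<open>lie_auto\<close> this asks neither for bijectivity nor for extensionality,
  so that homomorphisms can be compared on generators before they are known to be
  invertible.\<close>

definition lie_hom :: "complex set \<Rightarrow> ((complex \<times> nat \<Rightarrow>\<^sub>0 complex) \<Rightarrow> (complex \<times> nat \<Rightarrow>\<^sub>0 complex)) \<Rightarrow> bool" where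
  "lie_hom \<Gamma> \<phi> \<longleftrightarrow> \<phi> ` W \<Gamma> \<subseteq> W \<Gamma> \<and>
     (\<forall>x\<in>W \<Gamma>. \<forall>y\<in>W \<Gamma>. \<phi> (x + y) = \<phi> x + \<phi> y) \<and>
     (\<forall>c. \<forall>x\<in>W \<Gamma>. \<phi> (scale c x) = scale c (\<phi> x)) \<and>
     (\<forall>x\<in>W \<Gamma>. \<forall>y\<in>W \<Gamma>. \<phi> (bracket x y) = bracket (\<phi> x) (\<phi> y))"

lemma lie_homD:
  assumes "lie_hom \<Gamma> \<phi>"
  shows "x \<in> W \<Gamma> \<Longrightarrow> \<phi> x \<in> W \<Gamma>"
    and "x \<in> W \<Gamma> \<Longrightarrow> y \<in> W \<Gamma> \<Longrightarrow> \<phi> (x + y) = \<phi> x + \<phi> y"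
    and "x \<in> W \<Gamma> \<Longrightarrow> \<phi> (scale c x) = scale c (\<phi> x)"
    and "x \<in> W \<Gamma> \<Longrightarrow> y \<in> W \<Gamma> \<Longrightarrow> \<phi> (bracket x y) = bracket (\<phi> x) (\<phi> y)"
  using assms unfolding lie_hom_def by blast+

lemma lie_auto_iff: "\<phi> \<in> lie_auto \<Gamma> \<longleftrightarrow> \<phi> \<in> extensional (W \<Gamma>) \<and> bij_betw \<phi> (W \<Gamma>) (W \<Gamma>) \<and> lie_hom \<Gamma> \<phi>"
  unfolding lie_auto_def lie_hom_def Bij_def by (auto dest: bij_betw_imp_surj_on)

lemma lie_hom_comp:
  "lie_hom \<Gamma> \<phi> \<Longrightarrow> lie_hom \<Gamma> \<psi> \<Longrightarrow> lie_hom \<Gamma> (\<lambda>x. \<phi> (\<psi> x))"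
  unfolding lie_hom_def by (auto simp: image_subset_iff)

text \<open>
  The substitution satisfies \<open>der \<circ> subst = c subst \<circ> der\<close>, hence multiplies brackets by \<open>c\<close>; the
  factor \<open>inverse c\<close> compensates for this.
\<close>

definition std_auto ::
  "complex set \<Rightarrow> (complex \<Rightarrow> complex) \<Rightarrow> complex \<Rightarrow> complex \<Rightarrow> (complex \<times> nat \<Rightarrow>\<^sub>0 complex) \<Rightarrow> (complex \<times> nat \<Rightarrow>\<^sub>0 complex)" where
  "std_auto \<Gamma> \<tau> b c = (\<lambda>x\<in>W \<Gamma>. const (inverse c) * subst \<tau> b c x)"

context
  fixes \<Gamma> :: "complex set"
  assumes sub: "subgroup \<Gamma> complex_add_group"
begin

lemma W_mult:
  assumes "x \<in> W \<Gamma>" "y \<in> W \<Gamma>"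
  shows "x * y \<in> W \<Gamma>"
proof -
  have "fst k \<in> \<Gamma>" if k: "k \<in> Poly_Mapping.keys (x * y)" for k
  proof -
    obtain p q where "k = p + q" "p \<in> Poly_Mapping.keys x" "q \<in> Poly_Mapping.keys y"
      using subsetD[OF keys_mult, OF k] by blast
    then show ?thesis using assms by (auto simp: W_def intro!: add_mem[OF sub])
  qed
  then show ?thesis by (auto simp: W_def)
qed

lemma W_const: "const a \<in> W \<Gamma>"
  using W_single[OF zero_mem[OF sub], of 0 a] by (simp add: zero_prod_def)

lemma W_power: "x \<in> W \<Gamma> \<Longrightarrow> x ^ i \<in> W \<Gamma>"
  using W_const[of 1] by (induction i) (simp_all add: W_mult)

lemma W_subst:
  assumes "c \<in> scale_stabilizer \<Gamma>" "x \<in> W \<Gamma>"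
  shows "subst \<tau> b c x \<in> W \<Gamma>"
  unfolding subst_def
proof (rule W_sum)
  fix k assume "k \<in> Poly_Mapping.keys x"
  then have "fst k \<in> \<Gamma>" using assms(2) by (auto simp: W_def)
  then show "const (Poly_Mapping.lookup x k) * monom_image \<tau> b c k \<in> W \<Gamma>"
    unfolding monom_image_def using zero_mem[OF sub] scale_stabilizer_mem(1)[OF assms(1)]
    by (intro W_mult W_const W_power W_add W_single)
qed

lemma monom_image_add:
  assumes "\<tau> \<in> characters \<Gamma>" "\<alpha> \<in> \<Gamma>" "\<beta> \<in> \<Gamma>"
  shows "monom_image \<tau> b c (\<alpha> + \<beta>, i + j) = monom_image \<tau> b c (\<alpha>, i) * monom_image \<tau> b c (\<beta>, j)"
proof -
  have "Poly_Mapping.single (c * (\<alpha> + \<beta>), 0 :: nat) (\<tau> (\<alpha> + \<beta>)) =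
      Poly_Mapping.single (c * \<alpha>, 0) (\<tau> \<alpha>) * Poly_Mapping.single (c * \<beta>, 0) (\<tau> \<beta>)"
    using assms by (simp add: mult_single characters_iff distrib_left)
  then show ?thesis by (simp add: monom_image_def power_add mult_ac)
qed

text \<open>Characters are multiplicative on \<Gamma> only, whence the restriction to
  \<open>W \<Gamma>\<close>; there it suffices to compare single terms.\<close>

lemma subst_mult:
  assumes \<tau>: "\<tau> \<in> characters \<Gamma>" and x: "x \<in> W \<Gamma>" and y: "y \<in> W \<Gamma>"
  shows "subst \<tau> b c (x * y) = subst \<tau> b c x * subst \<tau> b c y"
  using x
proof (induction x rule: W_induct)
  case (add \<alpha> i a x)
  have "subst \<tau> b c (Poly_Mapping.single (\<alpha>, i) a * y) = subst \<tau> b c (Poly_Mapping.single (\<alpha>, i) a) * subst \<tau> b c y"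
    using y
  proof (induction y rule: W_induct)
    case (add \<beta> j d y)
    have "subst \<tau> b c (Poly_Mapping.single (\<alpha>, i) a * Poly_Mapping.single (\<beta>, j) d) =
        subst \<tau> b c (Poly_Mapping.single (\<alpha>, i) a) * subst \<tau> b c (Poly_Mapping.single (\<beta>, j) d)"
      unfolding mult_single subst_single
      using monom_image_add[OF \<tau> \<open>\<alpha> \<in> \<Gamma>\<close> \<open>\<beta> \<in> \<Gamma>\<close>] by (simp add: const_mult mult_ac)
    then show ?case using add by (simp add: distrib_left subst_add)
  qed simp
  then show ?case using add by (simp add: distrib_right subst_add)
qed simp

lemma lie_hom_std_auto:
  assumes \<tau>: "\<tau> \<in> characters \<Gamma>" and c: "c \<in> scale_stabilizer \<Gamma>"
  shows "lie_hom \<Gamma> (std_auto \<Gamma> \<tau> b c)"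
  unfolding lie_hom_def
proof (intro conjI ballI allI)
  have c0: "c \<noteq> 0" using c by (simp add: scale_stabilizer_def)
  have cc: "const c * (const (inverse c) * z) = z" for z
    using c0 by (simp add: mult.assoc[symmetric] mult_single)
  show "std_auto \<Gamma> \<tau> b c ` W \<Gamma> \<subseteq> W \<Gamma>"
    using c by (auto simp: std_auto_def intro!: W_mult W_const W_subst)
  fix x assume x: "x \<in> W \<Gamma>"
  show "std_auto \<Gamma> \<tau> b c (scale d x) = scale d (std_auto \<Gamma> \<tau> b c x)" for d
    using x W_scale[OF x, of d] by (simp add: std_auto_def scale_eq_mult subst_const_mult mult.left_commute)
  fix y assume y: "y \<in> W \<Gamma>"
  show "std_auto \<Gamma> \<tau> b c (x + y) = std_auto \<Gamma> \<tau> b c x + std_auto \<Gamma> \<tau> b c y"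
    using x y by (simp add: std_auto_def W_add subst_add distrib_left)
  \<comment> \<open>\<open>der\<close> is the bracket with the constant 1.\<close>
  have W_der: "der z \<in> W \<Gamma>" if "z \<in> W \<Gamma>" for z
    using W_bracket[OF sub W_const[of 1] that] by (simp add: bracket_eq)
  show "std_auto \<Gamma> \<tau> b c (bracket x y) = bracket (std_auto \<Gamma> \<tau> b c x) (std_auto \<Gamma> \<tau> b c y)"
    using x y W_bracket[OF sub x y]
    by (simp add: std_auto_def bracket_eq subst_diff subst_mult[OF \<tau>] W_der der_const_mult der_subst
        algebra_simps cc)
qed

lemma std_auto_L:
  assumes "\<alpha> \<in> \<Gamma>"
  shows "std_auto \<Gamma> \<tau> b c (L \<alpha> 0) = Poly_Mapping.single (c * \<alpha>, 0) (inverse c * \<tau> \<alpha>)"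
  using assms W_L[OF assms, of 0] by (simp add: std_auto_def L_def subst_single monom_image_def mult_single)

lemma std_auto_t:
  assumes "\<tau> \<in> characters \<Gamma>" "c \<noteq> 0"
  shows "std_auto \<Gamma> \<tau> b c (L 0 1) = L 0 1 + const (b / c)"
  using assms char_zero[OF sub assms(1)] zero_mem[OF sub] W_L[OF zero_mem[OF sub], of 1]
  by (simp add: std_auto_def L_def subst_single monom_image_def mult_single distrib_left
      divide_inverse mult.commute flip: zero_prod_def)

lemma char_one: "(\<lambda>\<alpha>\<in>\<Gamma>. 1) \<in> characters \<Gamma>"
  using add_mem[OF sub] by (simp add: characters_iff)

text \<open>The parameters can be read off from images: the dilation from that of
  \<open>L 0 0\<close>, then the character from those of \<open>L \<alpha> 0\<close>, and finally
  the translation from that of \<open>L 0 1\<close>.\<close>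

lemma std_auto_inj:
  assumes \<sigma>: "\<sigma> \<in> characters \<Gamma>" and \<tau>: "\<tau> \<in> characters \<Gamma>" and c: "c \<noteq> 0" and d: "d \<noteq> 0"
    and eq: "std_auto \<Gamma> \<sigma> a c = std_auto \<Gamma> \<tau> b d"
  shows "\<sigma> = \<tau>" "a = b" "c = d"
proof -
  have L: "Poly_Mapping.single (c * \<alpha>, 0) (inverse c * \<sigma> \<alpha>) = Poly_Mapping.single (d * \<alpha>, 0 :: nat) (inverse d * \<tau> \<alpha>)"
    if "\<alpha> \<in> \<Gamma>" for \<alpha>
    using fun_cong[OF eq, of "L \<alpha> 0"] by (simp add: std_auto_L[OF that])
  show "c = d"
    using arg_cong[OF L[OF zero_mem[OF sub]], of "\<lambda>x. Poly_Mapping.lookup x (0, 0)"] c d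
    by (simp add: char_zero[OF sub] \<sigma> \<tau>)
  then have "\<sigma> \<alpha> = \<tau> \<alpha>" if "\<alpha> \<in> \<Gamma>" for \<alpha>
    using arg_cong[OF L[OF that], of "\<lambda>x. Poly_Mapping.lookup x (d * \<alpha>, 0)"] d by simp
  then show "\<sigma> = \<tau>" using \<sigma> \<tau> by (intro extensionalityI[of _ \<Gamma>]) (auto simp: characters_iff)
  have "L 0 1 + const (a / c) = L 0 1 + const (b / d)"
    using fun_cong[OF eq, of "L 0 1"] unfolding std_auto_t[OF \<sigma> c] std_auto_t[OF \<tau> d] .
  then have "const (a / c) = const (b / d)" by simp
  then have "a / c = b / d" by (metis lookup_single_eq)
  then show "a = b" using \<open>c = d\<close> d by simp
qed

end

section \<open>Leading terms and locally finite adjoint action\<close>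

text \<open>For \<open>w \<noteq> 0\<close> the lexicographic order of these triples is a total
  order on exponents, compatible with addition. The weight \<open>w\<close> can be chosen to make
  the first component positive at a given exponent with nonzero \<alpha>.\<close>

definition rank :: "complex \<Rightarrow> complex \<times> nat \<Rightarrow> real \<times> real \<times> nat" where
  "rank w k = (Re (fst k * w), Im (fst k * w), snd k)"

lemma rank_add_mono: "rank w p' \<le> rank w p \<Longrightarrow> rank w q' \<le> rank w q \<Longrightarrow> rank w (p' + q') \<le> rank w (p + q)"
  by (auto simp: rank_def distrib_right)

lemma rank_add_strict_mono:
  "rank w p' < rank w p \<Longrightarrow> rank w q' \<le> rank w q \<Longrightarrow> rank w (p' + q') < rank w (p + q)"
  by (auto simp: rank_def distrib_right)

lemma rank_inj:
  assumes "w \<noteq> 0" "rank w p = rank w q"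
  shows "p = q"
proof -
  have "fst p * w = fst q * w" "snd p = snd q"
    using assms(2) by (simp_all add: rank_def complex_eq_iff)
  with assms(1) show ?thesis by (simp add: prod_eq_iff)
qed

text \<open>\<open>p\<close> need not occur in \<open>f\<close>: whether its coefficient vanishes is
  tracked separately, so that bounds pass through products and derivatives without side
  conditions.\<close>

definition bounded_by :: "complex \<Rightarrow> complex \<times> nat \<Rightarrow> (complex \<times> nat \<Rightarrow>\<^sub>0 complex) \<Rightarrow> bool" where
  "bounded_by w p f \<longleftrightarrow> (\<forall>k\<in>Poly_Mapping.keys f. rank w k \<le> rank w p)"

lemma bounded_by_mult:
  assumes "bounded_by w p f" "bounded_by w q g"
  shows "bounded_by w (p + q) (f * g)"
  unfolding bounded_by_def
proof
  fix k assume k: "k \<in> Poly_Mapping.keys (f * g)"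
  obtain a b where "k = a + b" "a \<in> Poly_Mapping.keys f" "b \<in> Poly_Mapping.keys g"
    using subsetD[OF keys_mult, OF k] by blast
  then show "rank w k \<le> rank w (p + q)"
    using assms by (auto simp: bounded_by_def intro: rank_add_mono)
qed

text \<open>Once the terms at \<open>p\<close> and \<open>q\<close> are split off, all remaining
  products have rank strictly below that of \<open>p + q\<close> and contribute nothing
  there.\<close>

lemma lookup_mult_bounded:
  assumes w: "w \<noteq> 0" and f: "bounded_by w p f" and g: "bounded_by w q g"
  shows "Poly_Mapping.lookup (f * g) (p + q) = Poly_Mapping.lookup f p * Poly_Mapping.lookup g q"
proof -
  have strict: "rank w k < rank w r"
    if "bounded_by w r h" "k \<in> Poly_Mapping.keys (h - Poly_Mapping.single r (Poly_Mapping.lookup h r))"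
    for r h k
  proof -
    have "k \<noteq> r" "k \<in> Poly_Mapping.keys h"
      using that(2) by (auto simp: in_keys_iff lookup_minus lookup_single when_def split: if_splits)
    then show ?thesis using that(1) rank_inj[OF w, of k r] by (force simp: bounded_by_def order_less_le)
  qed
  define f0 where "f0 = f - Poly_Mapping.single p (Poly_Mapping.lookup f p)"
  define g0 where "g0 = g - Poly_Mapping.single q (Poly_Mapping.lookup g q)"
  have vanish: "Poly_Mapping.lookup (x * y) (p + q) = 0"
    if "\<And>a b. a \<in> Poly_Mapping.keys x \<Longrightarrow> b \<in> Poly_Mapping.keys y \<Longrightarrow> rank w (a + b) < rank w (p + q)" for x y
  proof -
    have "p + q \<notin> Poly_Mapping.keys (x * y)"
    proof
      assume k: "p + q \<in> Poly_Mapping.keys (x * y)"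
      obtain a b where "p + q = a + b" "a \<in> Poly_Mapping.keys x" "b \<in> Poly_Mapping.keys y"
        using subsetD[OF keys_mult, OF k] by blast
      then show False using that[of a b] by simp
    qed
    then show ?thesis by (simp add: in_keys_iff)
  qed
  have "f * g = Poly_Mapping.single p (Poly_Mapping.lookup f p) * Poly_Mapping.single q (Poly_Mapping.lookup g q)
      + g0 * Poly_Mapping.single p (Poly_Mapping.lookup f p) + f0 * g"
    by (simp add: f0_def g0_def algebra_simps)
  moreover have "Poly_Mapping.lookup (f0 * g) (p + q) = 0"
  proof (rule vanish)
    fix a b assume "a \<in> Poly_Mapping.keys f0" "b \<in> Poly_Mapping.keys g"
    then show "rank w (a + b) < rank w (p + q)"
      using strict[OF f] g unfolding f0_def bounded_by_def by (intro rank_add_strict_mono) blast+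
  qed
  moreover have "Poly_Mapping.lookup (g0 * Poly_Mapping.single p (Poly_Mapping.lookup f p)) (p + q) = 0"
  proof (rule vanish)
    fix a b assume "a \<in> Poly_Mapping.keys g0" "b \<in> Poly_Mapping.keys (Poly_Mapping.single p (Poly_Mapping.lookup f p))"
    then have "rank w (a + b) < rank w (q + p)"
      using strict[OF g] unfolding g0_def by (intro rank_add_strict_mono) (auto split: if_splits)
    then show "rank w (a + b) < rank w (p + q)" by (simp add: add.commute)
  qed
  ultimately show ?thesis by (simp add: lookup_add mult_single)
qed

text \<open>The part of \<open>der\<close> that lowers the index could reach \<open>p\<close> only
  from a term of higher rank, which \<open>f\<close> lacks; so only multiplication by the exponent
  is seen at \<open>p\<close>.\<close>

lemma der_bounded:
  assumes "bounded_by w p f"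
  shows "bounded_by w p (der f)"
    and "Poly_Mapping.lookup (der f) p = fst p * Poly_Mapping.lookup f p"
proof -
  obtain \<alpha> i where p: "p = (\<alpha>, i)" by fastforce
  have "rank w (\<beta>, j) \<le> rank w p" if "(\<beta>, j) \<in> Poly_Mapping.keys (der f)" for \<beta> j
  proof -
    have "(\<beta>, j) \<in> Poly_Mapping.keys f \<or> (\<beta>, Suc j) \<in> Poly_Mapping.keys f"
      using that by (auto simp: in_keys_iff lookup_der)
    moreover have "rank w (\<beta>, j) \<le> rank w (\<beta>, Suc j)" by (simp add: rank_def)
    ultimately show ?thesis using assms unfolding bounded_by_def by (meson order_trans)
  qed
  then show "bounded_by w p (der f)" by (auto simp: bounded_by_def)
  have "(\<alpha>, Suc i) \<notin> Poly_Mapping.keys f"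
    using assms by (force simp: bounded_by_def p rank_def)
  then show "Poly_Mapping.lookup (der f) p = fst p * Poly_Mapping.lookup f p"
    by (simp add: p lookup_der in_keys_iff)
qed

lemma bracket_bounded:
  assumes w: "w \<noteq> 0" and f: "bounded_by w p f" and g: "bounded_by w q g"
  shows "bounded_by w (p + q) (bracket f g)"
    and "Poly_Mapping.lookup (bracket f g) (p + q) =
      (fst q - fst p) * Poly_Mapping.lookup f p * Poly_Mapping.lookup g q"
proof -
  have diff: "bounded_by w (p + q) (x - y)" if "bounded_by w (p + q) x" "bounded_by w (p + q) y" for x y
    using that by (auto simp: bounded_by_def in_keys_iff lookup_minus)
  show "bounded_by w (p + q) (bracket f g)"
    unfolding bracket_eq by (intro diff bounded_by_mult der_bounded f g)
  show "Poly_Mapping.lookup (bracket f g) (p + q) =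
      (fst q - fst p) * Poly_Mapping.lookup f p * Poly_Mapping.lookup g q"
    unfolding bracket_eq lookup_minus lookup_mult_bounded[OF w f der_bounded(1)[OF g]]
      lookup_mult_bounded[OF w der_bounded(1)[OF f] g] der_bounded(2)[OF f] der_bounded(2)[OF g]
    by (simp add: algebra_simps)
qed

lemma exists_bound:
  assumes "k \<in> Poly_Mapping.keys f"
  obtains p where "p \<in> Poly_Mapping.keys f" "bounded_by w p f"
proof -
  let ?R = "rank w ` Poly_Mapping.keys f"
  have "Max ?R \<in> ?R" using assms by (intro Max_in) auto
  then obtain p where p: "p \<in> Poly_Mapping.keys f" "rank w p = Max ?R" by auto
  have "bounded_by w p f" unfolding bounded_by_def p(2) by simp
  with p(1) show thesis by (rule that)
qed

text \<open>Local finiteness of the adjoint action refers to the Lie structure only, so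
  automorphisms preserve it. Finite spanning sets take the place of finite-dimensional
  subspaces.\<close>

definition ad_finite :: "complex set \<Rightarrow> (complex \<times> nat \<Rightarrow>\<^sub>0 complex) \<Rightarrow> bool" where
  "ad_finite \<Gamma> f \<longleftrightarrow> (\<forall>g\<in>W \<Gamma>. \<exists>S. finite S \<and> S \<subseteq> W \<Gamma> \<and>
     (\<forall>n. \<exists>u. (bracket f ^^ n) g = (\<Sum>s\<in>S. scale (u s) s)))"

lemma ad_finiteE:
  assumes "ad_finite \<Gamma> f" "g \<in> W \<Gamma>"
  obtains S where "finite S" "S \<subseteq> W \<Gamma>" "\<forall>n. \<exists>u. (bracket f ^^ n) g = (\<Sum>s\<in>S. scale (u s) s)"
proof -
  have "\<exists>S. finite S \<and> S \<subseteq> W \<Gamma> \<and> (\<forall>n. \<exists>u. (bracket f ^^ n) g = (\<Sum>s\<in>S. scale (u s) s))"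
    using assms(1)[unfolded ad_finite_def] assms(2) by (rule bspec)
  then show thesis by (elim exE conjE) (rule that)
qed

text \<open>
  The leading term of \<open>f\<close> multiplies the leading terms of the iterates of \<open>bracket f\<close>; the weight
  \<open>w\<close> makes that leading exponent nonzero, and the starting exponent \<open>\<beta>\<close> avoids cancellation.
\<close>

lemma ad_finite_imp_const:
  assumes sub: "subgroup \<Gamma> complex_add_group" and nontriv: "\<Gamma> \<noteq> {0}"
    and f: "f \<in> W \<Gamma>" "ad_finite \<Gamma> f"
  shows "f = const (Poly_Mapping.lookup f 0)"
proof (rule ccontr)
  assume "\<not> ?thesis"
  then obtain k where k: "Poly_Mapping.lookup f k \<noteq> Poly_Mapping.lookup (const (Poly_Mapping.lookup f 0)) k"
    by (meson poly_mapping_eqI)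
  then have k: "k \<noteq> 0" "k \<in> Poly_Mapping.keys f"
    by (auto simp: lookup_single when_def in_keys_iff split: if_splits)
  \<comment> \<open>If \<open>fst k\<close> is nonzero, its product with \<open>w\<close> is its
    squared absolute value; in either case \<open>k\<close> ranks above 0, so the leading exponent
    \<open>p\<close> cannot be 0.\<close>
  define w where "w = (if fst k = 0 then 1 else cnj (fst k))"
  have w: "w \<noteq> 0" by (simp add: w_def)
  obtain p where p: "p \<in> Poly_Mapping.keys f" "bounded_by w p f"
    using exists_bound[OF k(2)] by blast
  have p0: "p \<noteq> 0"
  proof
    assume "p = 0"
    then have "rank w k \<le> (0, 0, 0)" using p(2) k(2) by (auto simp: bounded_by_def rank_def)
    moreover have "(0, 0, 0) < rank w k"
    proof (cases "fst k = 0")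
      case True
      then show ?thesis using k(1) by (cases k) (simp add: rank_def zero_prod_def)
    next
      case False
      then have "w = cnj (fst k)" by (simp add: w_def)
      then have "fst k * w = of_real ((norm (fst k))\<^sup>2)" by (simp only: complex_norm_square)
      then have "0 < Re (fst k * w)" using False by simp
      then show ?thesis by (simp add: rank_def)
    qed
    ultimately show False by simp
  qed
  have fst_p: "fst p \<in> \<Gamma>" using p(1) f(1) by (auto simp: W_def)
  \<comment> \<open>The factor \<open>\<beta> + of_nat n * fst p - fst p\<close> enters the leading
    coefficient at each step and must never vanish. Any nonzero element of \<Gamma> will do if
    \<open>fst p = 0\<close>, and twice \<open>fst p\<close> otherwise.\<close>
  obtain \<beta> where \<beta>: "\<beta> \<in> \<Gamma>" "\<And>n. \<beta> + of_nat n * fst p \<noteq> fst p"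
  proof (cases "fst p = 0")
    case True
    obtain \<gamma> where "\<gamma> \<in> \<Gamma>" "\<gamma> \<noteq> 0" using nontriv zero_mem[OF sub] by blast
    then show thesis using True by (intro that[of \<gamma>]) simp_all
  next
    case False
    have "fst p + fst p + of_nat n * fst p \<noteq> fst p" for n
    proof
      assume "fst p + fst p + of_nat n * fst p = fst p"
      then have "of_nat (Suc n) * fst p = 0" by (simp add: algebra_simps)
      then show False using False by (simp del: of_nat_Suc)
    qed
    then show thesis using that add_mem[OF sub fst_p fst_p] by blast
  qed
  \<comment> \<open>\<open>q n\<close> is the leading exponent of the \<open>n\<close>-th iterate on
    \<open>L \<beta> 0\<close>. These exponents are pairwise distinct since
    \<open>p \<noteq> 0\<close>, but local finiteness confines them to a finite union of
    supports.\<close>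
  define q where "q = (\<lambda>n. (\<beta> + of_nat n * fst p, n * snd p))"
  have q_Suc: "q (Suc n) = p + q n" for n
    by (cases p) (simp add: q_def algebra_simps)
  have lead: "bounded_by w (q n) ((bracket f ^^ n) (L \<beta> 0)) \<and>
      Poly_Mapping.lookup ((bracket f ^^ n) (L \<beta> 0)) (q n) \<noteq> 0" for n
  proof (induction n)
    case 0
    show ?case by (simp add: bounded_by_def L_def q_def)
  next
    case (Suc n)
    have "fst (q n) - fst p \<noteq> 0" using \<beta>(2)[of n] by (simp add: q_def)
    then show ?case
      using Suc p(1) bracket_bounded[OF w p(2), of "q n"] by (simp add: q_Suc in_keys_iff)
  qed
  obtain S where S: "finite S" "S \<subseteq> W \<Gamma>"
    "\<forall>n. \<exists>u. (bracket f ^^ n) (L \<beta> 0) = (\<Sum>s\<in>S. scale (u s) s)"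
    by (rule ad_finiteE[OF f(2) W_L[OF \<beta>(1), of 0]])
  have "q n \<in> (\<Union>s\<in>S. Poly_Mapping.keys s)" for n
  proof -
    obtain u where "(bracket f ^^ n) (L \<beta> 0) = (\<Sum>s\<in>S. scale (u s) s)" using S(3) by blast
    then have "(\<Sum>s\<in>S. u s * Poly_Mapping.lookup s (q n)) \<noteq> 0"
      using lead[of n] by (simp add: lookup_sum)
    then obtain s where "s \<in> S" "u s * Poly_Mapping.lookup s (q n) \<noteq> 0" by (rule sum.not_neutral_contains_not_neutral)
    then show ?thesis by (auto simp: in_keys_iff)
  qed
  then have "finite (range q)"
    using S(1) by (intro finite_subset[of "range q" "\<Union>s\<in>S. Poly_Mapping.keys s"]) auto
  moreover have "inj q"
    using p0 by (cases p) (auto simp: inj_def q_def zero_prod_def)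
  ultimately show False by (simp add: finite_image_iff)
qed

text \<open>\<open>L 0 0\<close> acts as \<open>der\<close>, which keeps \<alpha> and never raises
  the index; so all iterates are supported on the finitely many exponents at or below those of
  \<open>g\<close>.\<close>

lemma ad_finite_L0: "ad_finite \<Gamma> (L 0 0)"
  unfolding ad_finite_def
proof
  fix g assume g: "g \<in> W \<Gamma>"
  define K where "K = (\<Union>k\<in>Poly_Mapping.keys g. {fst k} \<times> {..snd k})"
  have K: "finite K" "K \<subseteq> \<Gamma> \<times> UNIV" using g by (auto simp: K_def W_def)
  have bracket: "bracket (L 0 0) x = der x" for x
    by (simp add: bracket_eq L_def flip: zero_prod_def)
  have keys: "Poly_Mapping.keys ((bracket (L 0 0) ^^ n) g) \<subseteq> K" for n
  proof (induction n)
    case 0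
    show ?case by (force simp: K_def)
  next
    case (Suc n)
    show ?case
    proof
      fix k assume "k \<in> Poly_Mapping.keys ((bracket (L 0 0) ^^ Suc n) g)"
      then have "(fst k, snd k) \<in> Poly_Mapping.keys ((bracket (L 0 0) ^^ n) g) \<or>
          (fst k, Suc (snd k)) \<in> Poly_Mapping.keys ((bracket (L 0 0) ^^ n) g)"
        by (cases k) (auto simp: bracket in_keys_iff lookup_der)
      then have "(fst k, snd k) \<in> K \<or> (fst k, Suc (snd k)) \<in> K" using Suc by blast
      then show "k \<in> K" unfolding K_def by (cases k) force
    qed
  qed
  define e where "e = (\<lambda>k :: complex \<times> nat. Poly_Mapping.single k (1 :: complex))"
  have e_inj: "inj_on e K"
    by (rule inj_onI) (metis e_def keys_single singleton_inject zero_neq_one)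
  show "\<exists>S. finite S \<and> S \<subseteq> W \<Gamma> \<and> (\<forall>n. \<exists>u. (bracket (L 0 0) ^^ n) g = (\<Sum>s\<in>S. scale (u s) s))"
  proof (intro exI[of _ "e ` K"] conjI allI)
    show "finite (e ` K)" using K by simp
    show "e ` K \<subseteq> W \<Gamma>" using K(2) by (auto simp: e_def W_single)
    fix n
    let ?x = "(bracket (L 0 0) ^^ n) g"
    show "\<exists>u. ?x = (\<Sum>s\<in>e ` K. scale (u s) s)"
    proof (intro exI[of _ "\<lambda>s. Poly_Mapping.lookup ?x (inv_into K e s)"] poly_mapping_eqI)
      fix k
      have "Poly_Mapping.lookup (\<Sum>s\<in>e ` K. scale (Poly_Mapping.lookup ?x (inv_into K e s)) s) k
          = (\<Sum>l\<in>K. Poly_Mapping.lookup ?x l when l = k)"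
        by (simp add: sum.reindex[OF e_inj] lookup_sum inv_into_f_f[OF e_inj])
          (auto simp: e_def lookup_single when_def intro!: sum.cong)
      also have "\<dots> = Poly_Mapping.lookup ?x k"
        using keys[of n] K(1) by (auto simp: when_def in_keys_iff sum.delta)
      finally show "Poly_Mapping.lookup ?x k =
        Poly_Mapping.lookup (\<Sum>s\<in>e ` K. scale (Poly_Mapping.lookup ?x (inv_into K e s)) s) k" ..
    qed
  qed
qed

section \<open>Transport of local finiteness, and generators\<close>

context
  fixes \<Gamma> :: "complex set"
  assumes sub: "subgroup \<Gamma> complex_add_group"
begin

lemma lie_hom_sum:
  assumes \<phi>: "lie_hom \<Gamma> \<phi>" and A: "\<And>k. k \<in> A \<Longrightarrow> f k \<in> W \<Gamma>"
  shows "\<phi> (sum f A) = (\<Sum>k\<in>A. \<phi> (f k))"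
proof -
  have 0: "0 \<in> W \<Gamma>" by (simp add: W_def)
  have "\<phi> 0 = 0" using lie_homD(2)[OF \<phi> 0 0] by simp
  then show ?thesis using A
    by (induction A rule: infinite_finite_induct) (simp_all add: lie_homD(2)[OF \<phi>] W_sum)
qed

text \<open>The iterates of \<open>bracket (\<phi> f)\<close> are the images of those of
  \<open>bracket f\<close>: surjectivity gives a preimage of the vector acted on, and
  \<open>\<phi>\<close> carries its spanning set along.\<close>

lemma ad_finite_image:
  assumes \<phi>: "\<phi> \<in> lie_auto \<Gamma>" and f: "f \<in> W \<Gamma>" "ad_finite \<Gamma> f"
  shows "ad_finite \<Gamma> (\<phi> f)"
  unfolding ad_finite_def
proof
  fix g' assume "g' \<in> W \<Gamma>"
  have bij: "bij_betw \<phi> (W \<Gamma>) (W \<Gamma>)" and hom: "lie_hom \<Gamma> \<phi>" using \<phi> by (auto simp: lie_auto_iff)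
  obtain g where g: "g \<in> W \<Gamma>" "g' = \<phi> g" using bij \<open>g' \<in> W \<Gamma>\<close> by (auto simp: bij_betw_def)
  obtain S where S: "finite S" "S \<subseteq> W \<Gamma>" "\<forall>n. \<exists>u. (bracket f ^^ n) g = (\<Sum>s\<in>S. scale (u s) s)"
    by (rule ad_finiteE[OF f(2) g(1)])
  have inj: "inj_on \<phi> S" by (rule inj_on_subset[OF bij_betw_imp_inj_on[OF bij] S(2)])
  have iter: "(bracket f ^^ n) g \<in> W \<Gamma> \<and> (bracket (\<phi> f) ^^ n) g' = \<phi> ((bracket f ^^ n) g)" for n
    by (induction n) (simp_all add: g W_bracket[OF sub f(1)] lie_homD(4)[OF hom f(1)])
  show "\<exists>S. finite S \<and> S \<subseteq> W \<Gamma> \<and> (\<forall>n. \<exists>u. (bracket (\<phi> f) ^^ n) g' = (\<Sum>s\<in>S. scale (u s) s))"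
  proof (intro exI[of _ "\<phi> ` S"] conjI allI)
    show "finite (\<phi> ` S)" "\<phi> ` S \<subseteq> W \<Gamma>" using S lie_homD(1)[OF hom] by auto
    fix n
    obtain u where u: "(bracket f ^^ n) g = (\<Sum>s\<in>S. scale (u s) s)" using S(3) by blast
    have "\<phi> (\<Sum>s\<in>S. scale (u s) s) = (\<Sum>s\<in>S. \<phi> (scale (u s) s))"
      using S(2) by (intro lie_hom_sum[OF hom] W_scale) auto
    also have "\<dots> = (\<Sum>s\<in>S. scale (u s) (\<phi> s))"
      using S(2) by (intro sum.cong refl lie_homD(3)[OF hom]) auto
    also have "\<dots> = (\<Sum>s\<in>\<phi> ` S. scale (u (inv_into S \<phi> s)) s)"
      by (simp add: sum.reindex[OF inj] inv_into_f_f[OF inj])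
    finally show "\<exists>v. (bracket (\<phi> f) ^^ n) g' = (\<Sum>s\<in>\<phi> ` S. scale (v s) s)"
      using iter[of n] u by auto
  qed
qed

text \<open>\<open>W\<close> is generated by the \<open>L \<alpha> 0\<close> together with \<open>L 0 1\<close>.\<close>

lemma lie_hom_eqI:
  assumes nontriv: "\<Gamma> \<noteq> {0}" and \<phi>: "lie_hom \<Gamma> \<phi>" and \<psi>: "lie_hom \<Gamma> \<psi>"
    and L0: "\<And>\<alpha>. \<alpha> \<in> \<Gamma> \<Longrightarrow> \<phi> (L \<alpha> 0) = \<psi> (L \<alpha> 0)" and t: "\<phi> (L 0 1) = \<psi> (L 0 1)"
    and x: "x \<in> W \<Gamma>"
  shows "\<phi> x = \<psi> x"
proof -
  \<comment> \<open>\<open>E\<close> is a Lie subalgebra; it remains to produce every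
    \<open>L \<alpha> i\<close> in it.\<close>
  define E where "E = {x \<in> W \<Gamma>. \<phi> x = \<psi> x}"
  have E_add: "x + y \<in> E" if "x \<in> E" "y \<in> E" for x y
    using that lie_homD(2)[OF \<phi>] lie_homD(2)[OF \<psi>] by (simp add: E_def W_add)
  have E_scale: "scale c x \<in> E" if "x \<in> E" for c x
    using that lie_homD(3)[OF \<phi>] lie_homD(3)[OF \<psi>] by (simp add: E_def W_scale)
  have E_bracket: "bracket x y \<in> E" if "x \<in> E" "y \<in> E" for x y
    using that lie_homD(4)[OF \<phi>] lie_homD(4)[OF \<psi>] by (simp add: E_def W_bracket[OF sub])
  have E_cancel: "y \<in> E" if "scale c y + scale d z \<in> E" "c \<noteq> 0" "z \<in> E" for c d y z
  proof -
    have "y = scale (inverse c) ((scale c y + scale d z) + scale (- d) z)"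
      using that(2) by (intro poly_mapping_eqI) (simp add: lookup_add algebra_simps)
    also have "\<dots> \<in> E" by (intro E_scale E_add that)
    finally show ?thesis .
  qed
  \<comment> \<open>Bracketing with \<open>L 0 1\<close> raises the index with factor \<alpha>, up
    to a multiple of the previous vector.\<close>
  have L_nonzero: "L \<alpha> i \<in> E" if \<alpha>: "\<alpha> \<in> \<Gamma>" "\<alpha> \<noteq> 0" for \<alpha> i
  proof (induction i)
    case 0
    show ?case using L0[OF \<alpha>(1)] W_L[OF \<alpha>(1)] by (simp add: E_def)
  next
    case (Suc i)
    have "bracket (L 0 1) (L \<alpha> i) \<in> E"
      using Suc t W_L[OF zero_mem[OF sub]] by (intro E_bracket) (simp_all add: E_def)
    then have "scale \<alpha> (L \<alpha> (Suc i)) + scale (of_nat i - 1) (L \<alpha> i) \<in> E"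
      by (simp add: bracket_L L_bracket_def)
    then show ?case using \<alpha>(2) Suc by (rule E_cancel)
  qed
  obtain \<gamma> where \<gamma>: "\<gamma> \<in> \<Gamma>" "\<gamma> \<noteq> 0" using nontriv zero_mem[OF sub] by blast
  \<comment> \<open>For \<open>\<alpha> = 0\<close> that factor vanishes. Instead
    \<open>L (- \<gamma>) 0\<close> and \<open>L \<gamma> (Suc i)\<close> bracket to
    \<open>2 * \<gamma>\<close> times \<open>L 0 (Suc i)\<close> plus a multiple of
    \<open>L 0 i\<close>.\<close>
  have L_zero: "L 0 i \<in> E" for i
  proof (induction i)
    case 0
    show ?case using L0[OF zero_mem[OF sub]] W_L[OF zero_mem[OF sub]] by (simp add: E_def)
  next
    case (Suc i)
    have "bracket (L (- \<gamma>) 0) (L \<gamma> (Suc i)) \<in> E"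
      using \<gamma> minus_mem[OF sub] by (intro E_bracket L_nonzero) auto
    then have "scale (2 * \<gamma>) (L 0 (Suc i)) + scale (of_nat (Suc i)) (L 0 i) \<in> E"
      by (simp add: bracket_L L_bracket_def)
    then show ?case using Suc \<gamma>(2) by (intro E_cancel[of "2 * \<gamma>" "L 0 (Suc i)" "of_nat (Suc i)" "L 0 i"]) auto
  qed
  have "x \<in> E" using x
  proof (induction x rule: W_induct)
    case zero
    show ?case using E_scale[OF L_zero, of 0 0] by (simp add: scale_eq_mult)
  next
    case (add \<alpha> i a x)
    have "Poly_Mapping.single (\<alpha>, i) a = scale a (L \<alpha> i)"
      by (intro poly_mapping_eqI) (simp add: L_def lookup_single when_def)
    then show ?case using add L_zero L_nonzero by (cases "\<alpha> = 0") (simp_all add: E_add E_scale)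
  qed
  then show ?thesis by (simp add: E_def)
qed

end

section \<open>Group law and classification of the automorphisms\<close>

lemma single_eq_scale_L: "Poly_Mapping.single (\<alpha>, i) a = scale a (L \<alpha> i)"
  by (intro poly_mapping_eqI) (simp add: L_def lookup_single when_def)

lemma scale_single: "scale a (Poly_Mapping.single k d) = Poly_Mapping.single k (a * d)"
  by (intro poly_mapping_eqI) (simp add: lookup_single when_def)

lemma L_neq_0: "L \<alpha> i \<noteq> 0"
  unfolding L_def by (metis lookup_single_eq lookup_zero zero_neq_one)

context
  fixes \<Gamma> :: "complex set"
  assumes sub: "subgroup \<Gamma> complex_add_group" and nontriv: "\<Gamma> \<noteq> {0}"
begin

text \<open>Replacing \<open>t\<close> by \<open>c t + a\<close> in \<open>d t + b\<close> gives
  \<open>c d t + (d a + b)\<close>, and the outer character is evaluated at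
  \<open>d * \<alpha>\<close>. By \<open>lie_hom_eqI\<close> agreement on generators is
  enough.\<close>

lemma std_auto_comp:
  assumes \<sigma>: "\<sigma> \<in> characters \<Gamma>" and \<tau>: "\<tau> \<in> characters \<Gamma>"
    and c: "c \<in> scale_stabilizer \<Gamma>" and d: "d \<in> scale_stabilizer \<Gamma>" and x: "x \<in> W \<Gamma>"
  shows "std_auto \<Gamma> \<sigma> a c (std_auto \<Gamma> \<tau> b d x) =
    std_auto \<Gamma> (char_mult \<Gamma> (char_dilate \<Gamma> d \<sigma>) \<tau>) (d * a + b) (c * d) x"
proof -
  let ?\<rho> = "char_mult \<Gamma> (char_dilate \<Gamma> d \<sigma>) \<tau>"
  have \<rho>: "?\<rho> \<in> characters \<Gamma>"
    by (intro char_mult_closed[OF sub] char_dilate_closed[OF sub] \<sigma> \<tau> scale_stabilizer_multipliers d)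
  have cd: "c \<noteq> 0" "d \<noteq> 0" using c d by (simp_all add: scale_stabilizer_def)
  note hom = lie_hom_std_auto[OF sub]
  have scale_L: "std_auto \<Gamma> \<sigma> a c (Poly_Mapping.single (\<alpha>, 0) z) =
      Poly_Mapping.single (c * \<alpha>, 0) (z * (inverse c * \<sigma> \<alpha>))" if "\<alpha> \<in> \<Gamma>" for \<alpha> z
    unfolding single_eq_scale_L[of \<alpha> 0 z] lie_homD(3)[OF hom[OF \<sigma> c] W_L[OF that]]
      std_auto_L[OF sub that] scale_single ..
  show ?thesis
  proof (rule lie_hom_eqI[OF sub nontriv _ _ _ _ x, where
        \<phi> = "\<lambda>x. std_auto \<Gamma> \<sigma> a c (std_auto \<Gamma> \<tau> b d x)" and
        \<psi> = "std_auto \<Gamma> ?\<rho> (d * a + b) (c * d)"])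
    show "lie_hom \<Gamma> (\<lambda>x. std_auto \<Gamma> \<sigma> a c (std_auto \<Gamma> \<tau> b d x))"
      by (rule lie_hom_comp[OF hom[OF \<sigma> c] hom[OF \<tau> d]])
    show "lie_hom \<Gamma> (std_auto \<Gamma> ?\<rho> (d * a + b) (c * d))"
      by (rule hom[OF \<rho> scale_stabilizer_mult[OF c d]])
  next
    fix \<alpha> assume \<alpha>: "\<alpha> \<in> \<Gamma>"
    show "std_auto \<Gamma> \<sigma> a c (std_auto \<Gamma> \<tau> b d (L \<alpha> 0)) = std_auto \<Gamma> ?\<rho> (d * a + b) (c * d) (L \<alpha> 0)"
      unfolding std_auto_L[OF sub \<alpha>] scale_L[OF scale_stabilizer_mem(1)[OF d \<alpha>]]
      using \<alpha> by (simp add: char_mult_def char_dilate_def mult_ac)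
  next
    have 1: "const z = Poly_Mapping.single (0, 0) z" for z by (simp add: zero_prod_def)
    have "std_auto \<Gamma> \<sigma> a c (std_auto \<Gamma> \<tau> b d (L 0 1)) =
        std_auto \<Gamma> \<sigma> a c (L 0 1) + std_auto \<Gamma> \<sigma> a c (const (b / d))"
      unfolding std_auto_t[OF sub \<tau> cd(2)]
      by (intro lie_homD(2)[OF hom[OF \<sigma> c]] W_L zero_mem[OF sub] W_const[OF sub])
    also have "\<dots> = L 0 1 + (const (a / c) + const (b / d * inverse c))"
      unfolding std_auto_t[OF sub \<sigma> cd(1)] 1 scale_L[OF zero_mem[OF sub]] char_zero[OF sub \<sigma>]
      by simp
    also have "\<dots> = L 0 1 + const ((d * a + b) / (c * d))"
      unfolding single_add[symmetric] using cd by (simp add: field_simps)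
    finally show "std_auto \<Gamma> \<sigma> a c (std_auto \<Gamma> \<tau> b d (L 0 1)) = std_auto \<Gamma> ?\<rho> (d * a + b) (c * d) (L 0 1)"
      using std_auto_t[OF sub \<rho>] cd by simp
  qed
qed

lemma std_auto_id:
  assumes x: "x \<in> W \<Gamma>"
  shows "std_auto \<Gamma> (\<lambda>\<alpha>\<in>\<Gamma>. 1) 0 1 x = x"
proof (rule lie_hom_eqI[OF sub nontriv _ _ _ _ x, where \<psi> = "\<lambda>x. x"])
  show "lie_hom \<Gamma> (std_auto \<Gamma> (\<lambda>\<alpha>\<in>\<Gamma>. 1) 0 1)"
    by (intro lie_hom_std_auto[OF sub] char_one[OF sub]) (simp add: scale_stabilizer_def)
  show "lie_hom \<Gamma> (\<lambda>x. x)" by (simp add: lie_hom_def)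
  show "std_auto \<Gamma> (\<lambda>\<alpha>\<in>\<Gamma>. 1) 0 1 (L \<alpha> 0) = L \<alpha> 0" if "\<alpha> \<in> \<Gamma>" for \<alpha>
    using that by (simp add: std_auto_L[OF sub]) (simp add: L_def)
  show "std_auto \<Gamma> (\<lambda>\<alpha>\<in>\<Gamma>. 1) 0 1 (L 0 1) = L 0 1"
    using std_auto_t[OF sub char_one[OF sub], of 1 0] by simp
qed

lemma std_auto_in_lie_auto:
  assumes \<tau>: "\<tau> \<in> characters \<Gamma>" and c: "c \<in> scale_stabilizer \<Gamma>"
  shows "std_auto \<Gamma> \<tau> b c \<in> lie_auto \<Gamma>"
  unfolding lie_auto_iff
proof (intro conjI)
  show "std_auto \<Gamma> \<tau> b c \<in> extensional (W \<Gamma>)" by (simp add: std_auto_def)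
  show hom: "lie_hom \<Gamma> (std_auto \<Gamma> \<tau> b c)" by (rule lie_hom_std_auto[OF sub \<tau> c])
  define d where "d = inverse c"
  have d: "d \<in> scale_stabilizer \<Gamma>" "c * d = 1" "d * c = 1"
    using c by (auto simp: d_def scale_stabilizer_inverse) (auto simp: scale_stabilizer_def)
  \<comment> \<open>The parameters of the inverse are solved from \<open>std_auto_comp\<close>:
    \<open>\<sigma>\<close> dilated by \<open>c\<close> must invert \<open>\<tau>\<close>, and the
    translation \<open>- d * b\<close> makes \<open>c * (- d * b) + b\<close> vanish.\<close>
  define \<sigma> where "\<sigma> = char_dilate \<Gamma> (- d) \<tau>"
  have md: "- d \<in> multipliers \<Gamma>"
    using multipliers_ring(5)[OF sub multipliers_ring(3)[OF sub] scale_stabilizer_multipliers[OF d(1)]]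
    by simp
  have \<sigma>: "\<sigma> \<in> characters \<Gamma>" unfolding \<sigma>_def by (rule char_dilate_closed[OF sub \<tau> md])
  have inv: "char_mult \<Gamma> (char_dilate \<Gamma> (- 1) \<tau>) \<tau> = (\<lambda>\<alpha>\<in>\<Gamma>. 1)"
    by (rule char_mult_inverse[OF sub \<tau>])
  have "char_dilate \<Gamma> c \<sigma> = char_dilate \<Gamma> (- 1) \<tau>"
    using char_dilate_dilate[OF scale_stabilizer_multipliers[OF c], of "- d" \<tau>] d by (simp add: \<sigma>_def)
  then have 1: "std_auto \<Gamma> \<sigma> (- d * b) d (std_auto \<Gamma> \<tau> b c x) = x" if "x \<in> W \<Gamma>" for x
    using std_auto_comp[OF \<sigma> \<tau> d(1) c that, of "- d * b" b] d inv std_auto_id[OF that]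
    by (simp flip: mult.assoc)
  have "char_mult \<Gamma> (char_dilate \<Gamma> d \<tau>) \<sigma> = char_dilate \<Gamma> 0 \<tau>"
    using char_dilate_add[OF \<tau> scale_stabilizer_multipliers[OF d(1)] md] by (simp add: \<sigma>_def)
  then have 2: "std_auto \<Gamma> \<tau> b c (std_auto \<Gamma> \<sigma> (- d * b) d x) = x" if "x \<in> W \<Gamma>" for x
    using std_auto_comp[OF \<tau> \<sigma> c d(1) that, of b "- d * b"] d std_auto_id[OF that]
      char_dilate_zero[OF sub \<tau>] by simp
  show "bij_betw (std_auto \<Gamma> \<tau> b c) (W \<Gamma>) (W \<Gamma>)"
    using 1 2 lie_homD(1)[OF hom] lie_homD(1)[OF lie_hom_std_auto[OF sub \<sigma> d(1)]]
    by (intro bij_betw_byWitness[of _ "std_auto \<Gamma> \<sigma> (- d * b) d"]) auto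
qed

text \<open>
  Being ad-finite is invariant under automorphisms, so \<open>\<phi> (L 0 0)\<close> is constant and \<open>\<phi>\<close> conjugates
  \<open>der\<close> into a multiple of itself; hence it permutes the eigenvectors of \<open>der\<close> up to scalars.
\<close>

lemma lie_auto_std:
  assumes \<phi>: "\<phi> \<in> lie_auto \<Gamma>"
  obtains \<tau> b c where "\<tau> \<in> characters \<Gamma>" "c \<in> scale_stabilizer \<Gamma>" "\<phi> = std_auto \<Gamma> \<tau> b c"
proof -
  have bij: "bij_betw \<phi> (W \<Gamma>) (W \<Gamma>)" and hom: "lie_hom \<Gamma> \<phi>" and ext: "\<phi> \<in> extensional (W \<Gamma>)"
    using \<phi> by (auto simp: lie_auto_iff)
  note inj = inj_onD[OF bij_betw_imp_inj_on[OF bij]]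
  have zero: "0 \<in> W \<Gamma>" by (simp add: W_def)
  have \<phi>0: "\<phi> 0 = 0" using lie_homD(2)[OF hom zero zero] by simp
  have const: "const z = Poly_Mapping.single (0, 0) z" for z by (simp add: zero_prod_def)
  have L00: "L 0 0 \<in> W \<Gamma>" by (rule W_L[OF zero_mem[OF sub]])
  define a where "a = Poly_Mapping.lookup (\<phi> (L 0 0)) 0"
  have \<phi>1: "\<phi> (L 0 0) = const a"
    unfolding a_def
    by (rule ad_finite_imp_const[OF sub nontriv lie_homD(1)[OF hom L00] ad_finite_image[OF sub \<phi> L00 ad_finite_L0]])
  have a: "a \<noteq> 0"
  proof
    assume "a = 0"
    then have "\<phi> (L 0 0) = \<phi> 0" by (simp add: \<phi>1 \<phi>0)
    then have "L 0 0 = 0" by (rule inj[OF _ L00 zero])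
    then show False by (simp add: L_neq_0)
  qed
  have \<phi>_der: "\<phi> (der x) = scale a (der (\<phi> x))" "der x \<in> W \<Gamma>" if "x \<in> W \<Gamma>" for x
  proof -
    have "bracket (L 0 0) x = der x" by (simp add: bracket_eq L_def flip: const)
    moreover have "bracket (const a) (\<phi> x) = scale a (der (\<phi> x))"
      by (simp add: bracket_eq scale_eq_mult)
    ultimately show "\<phi> (der x) = scale a (der (\<phi> x))" "der x \<in> W \<Gamma>"
      using lie_homD(4)[OF hom L00 that] W_bracket[OF sub L00 that] by (simp_all add: \<phi>1)
  qed
  \<comment> \<open>A standard automorphism sends \<open>L 0 0\<close> to the constant
    \<open>inverse c\<close>, which dictates this value.\<close>
  define c where "c = inverse a"
  have c: "c \<noteq> 0" "a * c = 1" using a by (simp_all add: c_def)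
  define t where "t = (\<lambda>\<alpha>. Poly_Mapping.lookup (\<phi> (L \<alpha> 0)) (c * \<alpha>, 0))"
  have der_L: "der (L \<alpha> 0) = scale \<alpha> (L \<alpha> 0)" for \<alpha>
    by (simp add: L_def der_single scale_single)
  \<comment> \<open>Since \<open>\<phi>\<close> turns \<open>der\<close> into \<open>a\<close> times
    \<open>der\<close>, the image of \<open>L \<alpha> 0\<close> is an eigenvector of
    \<open>der\<close> with eigenvalue \<open>\<alpha> / a\<close>.\<close>
  have \<phi>_L: "\<phi> (L \<alpha> 0) = Poly_Mapping.single (c * \<alpha>, 0) (t \<alpha>)" if "\<alpha> \<in> \<Gamma>" for \<alpha>
    unfolding t_def
  proof (rule der_eigenvector, rule poly_mapping_eqI)
    fix k
    have "scale \<alpha> (\<phi> (L \<alpha> 0)) = scale a (der (\<phi> (L \<alpha> 0)))"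
      using \<phi>_der(1)[OF W_L[OF that, of 0]] lie_homD(3)[OF hom W_L[OF that, of 0]] by (simp add: der_L)
    from arg_cong[OF this, of "\<lambda>x. c * Poly_Mapping.lookup x k"] c(2)
    show "Poly_Mapping.lookup (der (\<phi> (L \<alpha> 0))) k = Poly_Mapping.lookup (scale (c * \<alpha>) (\<phi> (L \<alpha> 0))) k"
      by (simp add: mult.assoc[symmetric] mult.commute[of c a])
  qed
  have t: "t \<alpha> \<noteq> 0" if "\<alpha> \<in> \<Gamma>" for \<alpha>
  proof
    assume "t \<alpha> = 0"
    then have "\<phi> (L \<alpha> 0) = \<phi> 0" using \<phi>_L[OF that] by (simp add: \<phi>0)
    then have "L \<alpha> 0 = 0" by (rule inj[OF _ W_L[OF that] zero])
    then show False by (simp add: L_neq_0)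
  qed
  have c_stab: "c \<in> scale_stabilizer \<Gamma>"
  proof (rule scale_stabilizerI[OF c(1)])
    fix \<alpha> assume \<alpha>: "\<alpha> \<in> \<Gamma>"
    show "c * \<alpha> \<in> \<Gamma>"
      using lie_homD(1)[OF hom W_L[OF \<alpha>, of 0]] t[OF \<alpha>] by (simp add: \<phi>_L[OF \<alpha>] W_def)
    \<comment> \<open>The same argument run backwards: the preimage of \<open>L \<alpha> 0\<close>
      is an eigenvector with eigenvalue \<open>a * \<alpha>\<close>, which must therefore lie in
      \<Gamma>.\<close>
    obtain x where x: "x \<in> W \<Gamma>" "\<phi> x = L \<alpha> 0"
      using bij W_L[OF \<alpha>, of 0] by (metis bij_betw_imp_surj_on imageE)
    have "\<phi> (der x) = \<phi> (scale (a * \<alpha>) x)"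
      unfolding \<phi>_der(1)[OF x(1)] lie_homD(3)[OF hom x(1)] x(2) der_L
      by (intro poly_mapping_eqI) (simp add: mult.assoc)
    then have "der x = scale (a * \<alpha>) x" by (rule inj[OF _ \<phi>_der(2)[OF x(1)] W_scale[OF x(1)]])
    then have x_eq: "x = Poly_Mapping.single (a * \<alpha>, 0) (Poly_Mapping.lookup x (a * \<alpha>, 0))"
      by (rule der_eigenvector)
    have "x \<noteq> 0"
    proof
      assume "x = 0"
      then have "L \<alpha> 0 = 0" using x(2) \<phi>0 by simp
      then show False by (simp add: L_neq_0)
    qed
    then have "Poly_Mapping.lookup x (a * \<alpha>, 0) \<noteq> 0" using x_eq by (metis single_zero)
    then have "(a * \<alpha>, 0) \<in> Poly_Mapping.keys x" by (simp add: in_keys_iff)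
    then show "inverse c * \<alpha> \<in> \<Gamma>" using x(1) by (auto simp: c_def W_def)
  qed
  define \<tau> where "\<tau> = (\<lambda>\<alpha>\<in>\<Gamma>. c * t \<alpha>)"
  \<comment> \<open>Both sides of the bracket relation carry the factor
    \<open>\<beta> - \<alpha>\<close>, so equal arguments are out of reach here.\<close>
  have t_mult: "c * (t \<alpha> * t \<beta>) = t (\<alpha> + \<beta>)" if "\<alpha> \<in> \<Gamma>" "\<beta> \<in> \<Gamma>" "\<alpha> \<noteq> \<beta>" for \<alpha> \<beta>
  proof -
    have "\<phi> (bracket (L \<alpha> 0) (L \<beta> 0)) = scale (\<beta> - \<alpha>) (\<phi> (L (\<alpha> + \<beta>) 0))"
      using lie_homD(3)[OF hom W_L[OF add_mem[OF sub that(1,2)], of 0], of "\<beta> - \<alpha>"]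
      by (simp add: bracket_L L_bracket_def scale_eq_mult)
    moreover have "\<phi> (bracket (L \<alpha> 0) (L \<beta> 0)) =
        scale (t \<alpha> * t \<beta>) (scale (c * \<beta> - c * \<alpha>) (L (c * \<alpha> + c * \<beta>) 0))"
      unfolding lie_homD(4)[OF hom W_L[OF that(1)] W_L[OF that(2)]] \<phi>_L[OF that(1)] \<phi>_L[OF that(2)] bracket_single
      by (simp add: L_bracket_def scale_eq_mult)
    ultimately have "Poly_Mapping.single (c * \<alpha> + c * \<beta>, 0) ((\<beta> - \<alpha>) * t (\<alpha> + \<beta>)) =
        Poly_Mapping.single (c * \<alpha> + c * \<beta>, 0 :: nat) (t \<alpha> * t \<beta> * (c * \<beta> - c * \<alpha>))"
      using \<phi>_L[OF add_mem[OF sub that(1,2)]] by (simp add: L_def scale_single distrib_left)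
    then have "(\<beta> - \<alpha>) * t (\<alpha> + \<beta>) = t \<alpha> * t \<beta> * (c * \<beta> - c * \<alpha>)"
      by (metis lookup_single_eq)
    then have "(\<beta> - \<alpha>) * (c * (t \<alpha> * t \<beta>)) = (\<beta> - \<alpha>) * t (\<alpha> + \<beta>)" by (simp add: algebra_simps)
    then show ?thesis using that(3) by simp
  qed
  have \<tau>_0: "c * t 0 = 1"
    using \<phi>_L[OF zero_mem[OF sub]] \<phi>1 c(2) by (simp add: t_def const mult.commute)
  have \<tau>_mult: "c * t (\<alpha> + \<beta>) = (c * t \<alpha>) * (c * t \<beta>)" if "\<alpha> \<in> \<Gamma>" "\<beta> \<in> \<Gamma>" for \<alpha> \<beta>
  proof (cases "\<alpha> = \<beta>")
    case False
    then show ?thesis by (simp add: t_mult[OF that False, symmetric] mult_ac)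
  next
    case True
    show ?thesis
    proof (cases "\<alpha> = 0")
      case True
      then show ?thesis using \<open>\<alpha> = \<beta>\<close> \<tau>_0 by simp
    next
      case False
      \<comment> \<open>Doubling is reached through distinct arguments:
        \<open>\<alpha> + \<alpha>\<close> and \<open>- \<alpha>\<close> sum to \<alpha>, while
        \<alpha> and \<open>- \<alpha>\<close> sum to 0.\<close>
      have m: "- \<alpha> \<in> \<Gamma>" "\<alpha> + \<alpha> \<in> \<Gamma>" by (intro minus_mem[OF sub] add_mem[OF sub] that(1))+
      have "\<alpha> + \<alpha> \<noteq> - \<alpha>"
      proof
        assume "\<alpha> + \<alpha> = - \<alpha>"
        then have "3 * \<alpha> = 0" by (simp add: eq_neg_iff_add_eq_0 algebra_simps)
        then show False using False by simp
      qed
      then have 1: "c * (t (\<alpha> + \<alpha>) * t (- \<alpha>)) = t \<alpha>" using t_mult[OF m(2) m(1)] by simp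
      have "\<alpha> \<noteq> - \<alpha>" using False by (simp add: eq_neg_iff_add_eq_0)
      then have 2: "c * (t \<alpha> * t (- \<alpha>)) = t 0" using t_mult[OF that(1) m(1)] by simp
      have "c * t (\<alpha> + \<alpha>) = c * t (\<alpha> + \<alpha>) * (c * t 0)" using \<tau>_0 by simp
      also have "\<dots> = c * (t (\<alpha> + \<alpha>) * t (- \<alpha>)) * c * (c * t \<alpha>)"
        unfolding 2[symmetric] by (simp add: mult_ac)
      also have "\<dots> = (c * t \<alpha>) * (c * t \<alpha>)"
        unfolding 1 by (simp add: mult_ac)
      finally show ?thesis unfolding \<open>\<alpha> = \<beta>\<close> .
    qed
  qed
  have \<tau>: "\<tau> \<in> characters \<Gamma>"
    using t c(1) \<tau>_mult add_mem[OF sub] by (simp add: characters_iff \<tau>_def)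
  \<comment> \<open>\<open>der\<close> annihilates \<open>y\<close>, so \<open>y\<close> is an
    eigenvector for 0 and hence constant; writing it as \<open>b / c\<close> matches
    \<open>std_auto_t\<close>.\<close>
  define y where "y = \<phi> (L 0 1) - L 0 1"
  have L01: "L 0 1 \<in> W \<Gamma>" by (rule W_L[OF zero_mem[OF sub]])
  have der_t: "der (L 0 1) = L 0 0" by (simp add: L_def der_single)
  have "scale a (L 0 0) = scale a (der (\<phi> (L 0 1)))"
    using \<phi>_der(1)[OF L01] unfolding der_t \<phi>1 const single_eq_scale_L[of 0 0 a] .
  then have "a * Poly_Mapping.lookup (L 0 0) k = a * Poly_Mapping.lookup (der (\<phi> (L 0 1))) k" for k
    unfolding lookup_scale[symmetric] by simp
  then have "der (\<phi> (L 0 1)) = L 0 0"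
    using a by (intro poly_mapping_eqI) simp
  then have "der y = scale 0 y" using der_t by (simp add: y_def der_diff scale_eq_mult)
  then have "y = const (Poly_Mapping.lookup y (0, 0))" unfolding const by (rule der_eigenvector)
  then obtain b where "y = const (b / c)" using c(1) by (metis nonzero_mult_div_cancel_right)
  then have \<phi>_t: "\<phi> (L 0 1) = L 0 1 + const (b / c)" by (simp add: y_def algebra_simps)
  have "\<phi> x = std_auto \<Gamma> \<tau> b c x" if x: "x \<in> W \<Gamma>" for x
  proof (rule lie_hom_eqI[OF sub nontriv hom lie_hom_std_auto[OF sub \<tau> c_stab] _ _ x])
    show "\<phi> (L \<alpha> 0) = std_auto \<Gamma> \<tau> b c (L \<alpha> 0)" if "\<alpha> \<in> \<Gamma>" for \<alpha>
      using that c(1) by (simp add: \<phi>_L std_auto_L[OF sub] \<tau>_def flip: mult.assoc)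
    show "\<phi> (L 0 1) = std_auto \<Gamma> \<tau> b c (L 0 1)"
      unfolding \<phi>_t std_auto_t[OF sub \<tau> c(1)] ..
  qed
  then have "\<phi> = std_auto \<Gamma> \<tau> b c"
    by (intro extensionalityI[OF ext]) (simp_all add: std_auto_def)
  with \<tau> c_stab show thesis by (rule that)
qed

end

section \<open>Matching the semidirect product with the automorphism group\<close>

theorem theorem4p1:
  fixes \<Gamma> :: "complex set"
  assumes "subgroup \<Gamma> complex_add_group"
    and "\<Gamma> \<noteq> {0}"
  shows "Aut_W \<Gamma> \<cong> char_semidirect \<Gamma>"
proof -
  note sub = assms(1) and nontriv = assms(2)
  obtain \<theta> :: "(complex \<Rightarrow> complex) \<Rightarrow> (complex \<Rightarrow> complex)" and \<beta> :: "(complex \<Rightarrow> complex) \<Rightarrow> complex"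
    where bij: "bij_betw (\<lambda>\<tau>. (\<theta> \<tau>, \<beta> \<tau>)) (characters \<Gamma>) (characters \<Gamma> \<times> UNIV)"
    and \<theta>_mult: "\<And>\<sigma> \<tau>. \<sigma> \<in> characters \<Gamma> \<Longrightarrow> \<tau> \<in> characters \<Gamma> \<Longrightarrow>
      \<theta> (char_mult \<Gamma> \<sigma> \<tau>) = char_mult \<Gamma> (\<theta> \<sigma>) (\<theta> \<tau>)"
    and \<beta>_mult: "\<And>\<sigma> \<tau>. \<sigma> \<in> characters \<Gamma> \<Longrightarrow> \<tau> \<in> characters \<Gamma> \<Longrightarrow> \<beta> (char_mult \<Gamma> \<sigma> \<tau>) = \<beta> \<sigma> + \<beta> \<tau>"
    and \<theta>_dilate: "\<And>r \<tau>. r \<in> multipliers \<Gamma> \<Longrightarrow> \<tau> \<in> characters \<Gamma> \<Longrightarrow>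
      \<theta> (char_dilate \<Gamma> r \<tau>) = char_dilate \<Gamma> r (\<theta> \<tau>)"
    and \<beta>_dilate: "\<And>r \<tau>. r \<in> multipliers \<Gamma> \<Longrightarrow> \<tau> \<in> characters \<Gamma> \<Longrightarrow> \<beta> (char_dilate \<Gamma> r \<tau>) = r * \<beta> \<tau>"
    using characters_absorb_complex[OF sub nontriv] by blast
  have \<theta>: "\<theta> \<tau> \<in> characters \<Gamma>" if "\<tau> \<in> characters \<Gamma>" for \<tau>
    using bij_betwE[OF bij] that by blast
  \<comment> \<open>As \<open>\<tau>\<close> varies,
    \<open>(\<theta> \<tau>, \<beta> \<tau>)\<close> runs once through all pairs of a character and
    a translation, so \<open>h\<close> reaches every standard automorphism without a separate
    translation parameter.\<close>
  define h where "h = (\<lambda>(\<tau>, c). std_auto \<Gamma> (\<theta> \<tau>) (\<beta> \<tau>) c)"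
  have h: "h (\<tau>, c) \<in> lie_auto \<Gamma>" if "\<tau> \<in> characters \<Gamma>" "c \<in> scale_stabilizer \<Gamma>" for \<tau> c
    using std_auto_in_lie_auto[OF sub nontriv \<theta>[OF that(1)] that(2)] by (simp add: h_def)
  have mult: "h (x \<otimes>\<^bsub>char_semidirect \<Gamma>\<^esub> y) = h x \<otimes>\<^bsub>Aut_W \<Gamma>\<^esub> h y"
    if xy: "x \<in> carrier (char_semidirect \<Gamma>)" "y \<in> carrier (char_semidirect \<Gamma>)" for x y
  proof -
    obtain \<sigma> c \<tau> d where x: "x = (\<sigma>, c)" "\<sigma> \<in> characters \<Gamma>" "c \<in> scale_stabilizer \<Gamma>"
      and y: "y = (\<tau>, d)" "\<tau> \<in> characters \<Gamma>" "d \<in> scale_stabilizer \<Gamma>"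
      using xy by (auto simp: char_semidirect_def)
    have d: "d \<in> multipliers \<Gamma>" by (rule scale_stabilizer_multipliers[OF y(3)])
    \<comment> \<open>The character part has the form found in \<open>std_auto_comp\<close>, and
      equivariance of \<open>\<beta>\<close> under the dilation by \<open>d\<close> produces exactly
      its translation part.\<close>
    have "x \<otimes>\<^bsub>char_semidirect \<Gamma>\<^esub> y = (char_mult \<Gamma> (char_dilate \<Gamma> d \<sigma>) \<tau>, c * d)"
      by (auto simp: x(1) y(1) char_semidirect_def char_mult_def char_dilate_def fun_eq_iff)
    then have "h (x \<otimes>\<^bsub>char_semidirect \<Gamma>\<^esub> y) =
        std_auto \<Gamma> (char_mult \<Gamma> (char_dilate \<Gamma> d (\<theta> \<sigma>)) (\<theta> \<tau>)) (d * \<beta> \<sigma> + \<beta> \<tau>) (c * d)"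
      using x y d
      by (simp add: h_def \<theta>_mult \<theta>_dilate \<beta>_mult \<beta>_dilate char_dilate_closed[OF sub])
    also have "\<dots> = compose (W \<Gamma>) (h x) (h y)"
      using std_auto_comp[OF sub nontriv \<theta>[OF x(2)] \<theta>[OF y(2)] x(3) y(3)]
      by (auto simp: h_def x(1) y(1) compose_def fun_eq_iff) (simp add: std_auto_def)
    also have "\<dots> = h x \<otimes>\<^bsub>Aut_W \<Gamma>\<^esub> h y"
      using h[OF x(2,3)] h[OF y(2,3)] by (simp add: Aut_W_def BijGroup_def lie_auto_def x(1) y(1))
    finally show ?thesis .
  qed
  have inj: "inj_on h (characters \<Gamma> \<times> scale_stabilizer \<Gamma>)"
  proof (rule inj_onI, clarify)
    fix \<sigma> c \<tau> d assume \<sigma>: "\<sigma> \<in> characters \<Gamma>" "c \<in> scale_stabilizer \<Gamma>"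
      and \<tau>: "\<tau> \<in> characters \<Gamma>" "d \<in> scale_stabilizer \<Gamma>" and eq: "h (\<sigma>, c) = h (\<tau>, d)"
    have "c \<noteq> 0" "d \<noteq> 0" using \<sigma> \<tau> by (auto simp: scale_stabilizer_def)
    note * = std_auto_inj[OF sub \<theta>[OF \<sigma>(1)] \<theta>[OF \<tau>(1)] this eq[unfolded h_def prod.case]]
    show "\<sigma> = \<tau> \<and> c = d"
      using *(3) inj_onD[OF bij_betw_imp_inj_on[OF bij] _ \<sigma>(1) \<tau>(1)] *(1,2) by simp
  qed
  have surj: "lie_auto \<Gamma> \<subseteq> h ` (characters \<Gamma> \<times> scale_stabilizer \<Gamma>)"
  proof
    fix \<phi> assume "\<phi> \<in> lie_auto \<Gamma>"
    then obtain \<tau> b c where \<phi>: "\<tau> \<in> characters \<Gamma>" "c \<in> scale_stabilizer \<Gamma>" "\<phi> = std_auto \<Gamma> \<tau> b c"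
      by (rule lie_auto_std[OF sub nontriv])
    have "(\<tau>, b) \<in> (\<lambda>\<tau>. (\<theta> \<tau>, \<beta> \<tau>)) ` characters \<Gamma>"
      using \<phi>(1) bij by (simp add: bij_betw_def)
    then obtain \<sigma> where "\<sigma> \<in> characters \<Gamma>" "\<theta> \<sigma> = \<tau>" "\<beta> \<sigma> = b" by auto
    then show "\<phi> \<in> h ` (characters \<Gamma> \<times> scale_stabilizer \<Gamma>)"
      using \<phi> by (intro image_eqI[of _ _ "(\<sigma>, c)"]) (simp_all add: h_def)
  qed
  have "h \<in> iso (char_semidirect \<Gamma>) (Aut_W \<Gamma>)"
    unfolding iso_def hom_def
  proof (intro CollectI conjI)
    show "h \<in> carrier (char_semidirect \<Gamma>) \<rightarrow> carrier (Aut_W \<Gamma>)"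
      using h by (auto simp: char_semidirect_def Aut_W_def)
    show "bij_betw h (carrier (char_semidirect \<Gamma>)) (carrier (Aut_W \<Gamma>))"
      using inj surj h by (auto simp: bij_betw_def char_semidirect_def Aut_W_def)
  qed (use mult in blast)
  then have "char_semidirect \<Gamma> \<cong> Aut_W \<Gamma>" by (rule is_isoI)
  then show ?thesis by (rule group.iso_sym[OF group_char_semidirect[OF sub]])
qed

end
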